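(* Let $m\ge 3$ be odd, let $0\le i<j<m$ be integers, $\rho=2^i+2^j$, $\kappa=j-i$, and $\Gamma_\rho(x)=x^\rho+x$ on $\mathrm{GF}(2^m)$. Suppose $\Gamma_\rho$ is two-to-one on $\mathrm{GF}(2^m)$ (every element of $\mathrm{GF}(2^m)$ has either exactly $2$ or no preimages) and $\gcd(2^\kappa+1,2^m-1)=1$. Let $D(\Gamma_\rho)=\{\Gamma_\rho(x):x\in\mathrm{GF}(2^m)\}\setminus\{0\}$. Then the binary code $\mathcal{C}_{D(\Gamma_\rho)}$ has parameters $[2^{m-1}-1,\ m,\ 2^{m-2}-2^{(m-3)/2}]$ and its nonzero weights and their multiplicities are: weight $2^{m-2}-2^{(m-3)/2}$ with multiplicity $2^{m-2}+2^{(m-3)/2}$; weight $2^{m-2}$ with multiplicity $2^{m-1}-1$; weight $2^{m-2}+2^{(m-3)/2}$ with multiplicity $2^{m-2}-2^{(m-3)/2}$.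
   Context: $\mathrm{Tr}$ denotes the absolute trace from $\mathrm{GF}(2^m)$ onto $\mathrm{GF}(2)$. For a subset $D=\{d_1,\dots,d_n\}\subseteq\mathrm{GF}(2^m)$ (listed in a fixed order), $\mathcal{C}_D=\{(\mathrm{Tr}(xd_1),\dots,\mathrm{Tr}(xd_n)) : x\in\mathrm{GF}(2^m)\}$, a binary linear code of length $n$. *)

theory Defs
  imports Main
begin

text \<open>GF(2^m) is modelled as an arbitrary finite field type 'a with CARD('a) = 2^m
 (unique up to isomorphism). The absolute trace onto GF(2) (= the prime subfield {0,1}).\<close>

definition abs_trace :: "nat \<Rightarrow> 'a::field \<Rightarrow> 'a" where
  "abs_trace m x = (\<Sum>k<m. x ^ (2 ^ k))"

definition codeword :: "nat \<Rightarrow> 'a::field set \<Rightarrow> 'a \<Rightarrow> ('a \<Rightarrow> 'a)" where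
  "codeword m D x = (\<lambda>d. if d \<in> D then abs_trace m (x * d) else 0)"

definition code_D :: "nat \<Rightarrow> 'a::field set \<Rightarrow> ('a \<Rightarrow> 'a) set" where
  "code_D m D = range (codeword m D)"

definition hweight :: "'a::field set \<Rightarrow> ('a \<Rightarrow> 'a) \<Rightarrow> nat" where
  "hweight D c = card {d \<in> D. c d \<noteq> 0}"

definition min_distance :: "nat \<Rightarrow> 'a::field set \<Rightarrow> nat" where
  "min_distance m D = Min (hweight D ` (code_D m D - {\<lambda>_. 0}))"

definition weight_mult :: "nat \<Rightarrow> 'a::field set \<Rightarrow> nat \<Rightarrow> nat" where
  "weight_mult m D w = card {c \<in> code_D m D. c \<noteq> (\<lambda>_. 0) \<and> hweight D c = w}"

end

theory Submission
  imports Defs "HOL-Number_Theory.Number_Theory" "HOL-Computational_Algebra.Polynomial"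
    "HOL-Library.Nat_Bijection"
begin

text \<open>
  Put \<open>\<rho> = 2\<^sup>i + 2\<^sup>j\<close>, \<open>\<kappa> = j - i\<close>, \<open>\<Gamma>(x) = x\<^sup>\<rho> + x\<close> and let \<open>W(a)\<close> be the sum of the signs
  \<open>(-1)\<close>-to-the-\<open>Tr(a \<Gamma>(x))\<close> over all \<open>x\<close>. As \<open>\<Gamma>\<close> is two-to-one, the codeword of \<open>a\<close> has weight
  \<open>(2\<^sup>m - W(a)) / 4\<close>. Squaring \<open>W(a)\<close> for \<open>a \<noteq> 0\<close> and substituting \<open>y = x + h\<close> makes the inner sum a
  character sum of a linear form in \<open>x\<close>, which survives only for \<open>h = 0\<close> and, provided
  \<open>gcd(\<kappa>, m) = 1\<close>, for the unique \<open>h\<close> with \<open>a h\<^sup>\<rho> = 1\<close>. Hence \<open>W(a)\<^sup>2\<close> is \<open>0\<close> or \<open>2 \<cdot> 2\<^sup>m\<close>, and the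
  first two moments of \<open>W\<close>, which only depend on \<open>\<Gamma>\<close> being two-to-one, determine the multiplicities.

  The coprimality of \<open>\<kappa>\<close> and \<open>m\<close> is itself a consequence of \<open>\<Gamma>\<close> being two-to-one. By Glynn's
  criterion for monomial hyperovals, there is no \<open>0 < d < 2\<^sup>m - 1\<close> whose binary digits are contained
  in those of \<open>\<rho> d\<close> reduced modulo \<open>2\<^sup>m - 1\<close>; but if \<open>e = gcd(\<kappa>, m) > 1\<close>, then such a \<open>d\<close> exists:
  about half of the digit positions, or half of those divisible by \<open>e\<close>, suitably chosen.
\<close>

section \<open>Exponents violating Glynn's criterion\<close>

lemma set_encode_lessThan: "set_encode {..<m} = 2 ^ m - 1"
  unfolding set_encode_def by (induction m) auto

lemma cong_power2_mod: "[2 ^ (a mod m) = 2 ^ a] (mod (2 ^ m - 1 :: nat))"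
proof -
  have "[2 ^ m = 1] (mod (2 ^ m - 1 :: nat))"
    using mod_add_self1[of "2 ^ m - 1" "1 :: nat"] by (simp add: cong_def)
  hence "[(2 ^ m) ^ (a div m) * 2 ^ (a mod m) = 1 ^ (a div m) * 2 ^ (a mod m)] (mod (2 ^ m - 1 :: nat))"
    by (intro cong_mult cong_pow cong_refl)
  moreover have "(2 ^ m) ^ (a div m) * 2 ^ (a mod m) = (2 :: nat) ^ a"
    by (simp flip: power_mult power_add)
  ultimately show ?thesis by (simp add: cong_sym)
qed

text \<open>Injectivity of the reduced exponents rules out carries, so the reduced powers are
  distinct binary digits.\<close>

lemma cong_sum_power2_set_encode:
  assumes "inj_on (\<lambda>t. f t mod m) A"
  shows "[(\<Sum>t\<in>A. 2 ^ f t) = set_encode ((\<lambda>t. f t mod m) ` A)] (mod (2 ^ m - 1))"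
proof -
  have "set_encode ((\<lambda>t. f t mod m) ` A) = (\<Sum>t\<in>A. 2 ^ (f t mod m))"
    using assms by (simp add: set_encode_def sum.reindex)
  moreover have "[(\<Sum>t\<in>A. 2 ^ (f t mod m)) = (\<Sum>t\<in>A. 2 ^ f t)] (mod (2 ^ m - 1 :: nat))"
    by (intro cong_sum cong_power2_mod)
  ultimately show ?thesis by (simp add: cong_sym)
qed

lemma inj_on_add_mod: "inj_on (\<lambda>a. (a + i) mod m) {..<m :: nat}"
proof (rule inj_onI)
  fix a b assume ab: "a \<in> {..<m}" "b \<in> {..<m}" "(a + i) mod m = (b + i) mod m"
  hence "[a + i = b + i] (mod m)" by (simp add: cong_def)
  hence "[a = b] (mod m)" by (simp add: cong_add_rcancel_nat)
  thus "a = b" using ab by (auto simp: cong_def)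
qed

text \<open>As \<open>2 ^ m\<close> is congruent to 1, a digit pushed past position
  \<open>m - 1\<close> re-enters at 0.\<close>

lemma cong_power2_mult_set_encode:
  assumes "A \<subseteq> {..<m}"
  shows "[2 ^ i * set_encode A = set_encode ((\<lambda>a. (a + i) mod m) ` A)] (mod (2 ^ m - 1))"
proof -
  have "2 ^ i * set_encode A = (\<Sum>a\<in>A. 2 ^ (a + i))"
    by (simp add: set_encode_def sum_distrib_left power_add mult.commute)
  moreover have "inj_on (\<lambda>a. (a + i) mod m) A"
    using inj_on_add_mod assms by (rule inj_on_subset)
  ultimately show ?thesis using cong_sum_power2_set_encode by metis
qed

text \<open>The rotation is inverted into a condition on \<open>b - i\<close>; as this can be
  negative, residues are taken in the integers.\<close>

lemma image_add_mod:
  assumes "i < (m :: nat)"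
  shows "(\<lambda>a. (a + i) mod m) ` {a. a < m \<and> P (int a mod int m)} =
    {b. b < m \<and> P ((int b - int i) mod int m)}"
proof (intro equalityI subsetI)
  fix b assume "b \<in> (\<lambda>a. (a + i) mod m) ` {a. a < m \<and> P (int a mod int m)}"
  then obtain a where a: "a < m" "P (int a mod int m)" "b = (a + i) mod m" by auto
  have "(int b - int i) mod int m = (int a + int i - int i) mod int m"
    unfolding a(3) by (simp add: zmod_int mod_diff_left_eq)
  thus "b \<in> {b. b < m \<and> P ((int b - int i) mod int m)}" using a by simp
next
  fix b assume b: "b \<in> {b. b < m \<and> P ((int b - int i) mod int m)}"
  define a where "a = (b + m - i) mod m"
  have "[a + i = b + m - i + i] (mod m)" by (simp add: a_def cong_def mod_add_left_eq)
  hence "(a + i) mod m = b" using b assms by (simp add: cong_def)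
  moreover have "int a mod int m = (int b - int i) mod int m"
  proof -
    have "int a = (int b + int m - int i) mod int m"
      using assms by (simp add: a_def zmod_int of_nat_diff)
    also have "int b + int m - int i = (int b - int i) + int m" by simp
    finally show ?thesis by simp
  qed
  ultimately show "b \<in> (\<lambda>a. (a + i) mod m) ` {a. a < m \<and> P (int a mod int m)}"
    using b assms by (intro image_eqI[of _ _ a]) (auto simp: a_def)
qed

text \<open>Multiplication by \<open>w\<close> turns the shifts by \<open>i\<close> and \<open>j\<close> of the set \<open>D\<close> into the two adjacent arcs
  \<open>[P, P + W)\<close> and \<open>[P + W, P + 2 W)\<close> of the integers modulo \<open>m\<close>, where \<open>P = w i\<close>; no carries occur, and the
  bound on \<open>P\<close> keeps the uncovered arc of length \<open>e\<close> away from \<open>D\<close> itself.\<close>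

lemma glynn_sets_interval:
  fixes m i j e w W :: nat
  assumes ij: "i < j" "j < m" and W: "m = 2 * W + e" "W > 0"
    and w1: "[w * (j - i) = W] (mod m)" and w2: "(w * i) mod m \<ge> W + e"
  shows "\<exists>D T. D \<subseteq> T \<and> T \<subseteq> {..<m} \<and> D \<noteq> {} \<and> D \<noteq> {..<m} \<and>
    [(2 ^ i + 2 ^ j) * set_encode D = set_encode T] (mod (2 ^ m - 1))"
proof -
  define D where "D = {a. a < m \<and> (int w * (int a mod int m)) mod int m < int W}"
  \<comment> \<open>The coordinate \<open>w * b\<close> is recentred at \<open>i\<close>, so that
    both shifts of \<open>D\<close> become conditions on one function.\<close>
  define f where "f b = (int w * (int b - int i)) mod int m" for b
  have m0: "m > 0" using W by simp
  have f: "0 \<le> f b" "f b < int m" for b using m0 by (auto simp: f_def)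
  have Di: "(\<lambda>a. (a + i) mod m) ` D = {b. b < m \<and> f b < int W}"
    unfolding D_def using ij
    by (subst image_add_mod[where P = "\<lambda>z. (int w * z) mod int m < int W"])
       (auto simp: f_def mod_mult_right_eq)
  \<comment> \<open>Passing from \<open>i\<close> to \<open>j\<close> subtracts
    \<open>w * (j - i)\<close>, which is \<open>W\<close> modulo \<open>m\<close>.\<close>
  have shift: "(int w * (int b - int j)) mod int m = (f b - int W) mod int m" for b
  proof -
    have "[int (w * (j - i)) = int W] (mod int m)" using w1 by (simp only: cong_int_iff)
    hence "[int w * (int b - int i) - int (w * (j - i)) = f b - int W] (mod int m)"
      by (intro cong_diff) (auto simp: f_def cong_def)
    moreover have "int w * (int b - int i) - int (w * (j - i)) = int w * (int b - int j)"
      using ij by (simp add: of_nat_diff algebra_simps)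
    ultimately show ?thesis by (simp add: cong_def)
  qed
  have "(\<lambda>a. (a + j) mod m) ` D = {b. b < m \<and> (f b - int W) mod int m < int W}"
    unfolding D_def using ij
    by (subst image_add_mod[where P = "\<lambda>z. (int w * z) mod int m < int W"])
       (auto simp: mod_mult_right_eq shift)
  also have "\<dots> = {b. b < m \<and> int W \<le> f b \<and> f b < 2 * int W}"
  proof -
    have "(f b - int W) mod int m < int W \<longleftrightarrow> int W \<le> f b \<and> f b < 2 * int W" for b
    proof (cases "int W \<le> f b")
      case True
      hence "(f b - int W) mod int m = f b - int W" using f[of b] by (intro mod_pos_pos_trivial) auto
      thus ?thesis using True by auto
    next
      case False
      have "(f b - int W) mod int m = (f b - int W + int m) mod int m" by simp
      also have "\<dots> = f b - int W + int m"
        using False f[of b] W by (intro mod_pos_pos_trivial) auto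
      finally show ?thesis using False f[of b] W by auto
    qed
    thus ?thesis by auto
  qed
  finally have Dj: "(\<lambda>a. (a + j) mod m) ` D = {b. b < m \<and> int W \<le> f b \<and> f b < 2 * int W}" .
  define T where "T = {b. b < m \<and> f b < 2 * int W}"
  have "[2 ^ i * set_encode D + 2 ^ j * set_encode D = set_encode {b. b < m \<and> f b < int W} +
    set_encode {b. b < m \<and> int W \<le> f b \<and> f b < 2 * int W}] (mod (2 ^ m - 1))"
    unfolding Di[symmetric] Dj[symmetric]
    by (intro cong_add cong_power2_mult_set_encode) (auto simp: D_def)
  also have "set_encode {b. b < m \<and> f b < int W} +
      set_encode {b. b < m \<and> int W \<le> f b \<and> f b < 2 * int W} = set_encode T"
  proof -
    have "T = {b. b < m \<and> f b < int W} \<union> {b. b < m \<and> int W \<le> f b \<and> f b < 2 * int W}"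
      by (auto simp: T_def)
    thus ?thesis unfolding set_encode_def by (simp only:) (subst sum.union_disjoint, auto)
  qed
  finally have "[(2 ^ i + 2 ^ j) * set_encode D = set_encode T] (mod (2 ^ m - 1))"
    by (simp add: algebra_simps)
  moreover have "D \<subseteq> T"
  proof
    fix b assume b: "b \<in> D"
    show "b \<in> T"
    proof (rule ccontr)
      \<comment> \<open>Here \<open>f b\<close> lies in the uncovered arc; adding \<open>P\<close>
        wraps around exactly once and ends at \<open>W\<close> or beyond, hence outside the arc that
        defines \<open>D\<close>.\<close>
      assume "b \<notin> T"
      hence fb: "f b \<ge> 2 * int W" using b by (auto simp: D_def T_def)
      define P where "P = int ((w * i) mod m)"
      have P: "P \<ge> int W + int e" "P < int m" using w2 m0 by (auto simp: P_def)
      have "[f b + P = int w * (int b - int i) + int (w * i)] (mod int m)"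
        by (intro cong_add) (auto simp: f_def P_def cong_def zmod_int)
      also have "int w * (int b - int i) + int (w * i) = int w * int b" by (simp add: algebra_simps)
      finally have "(int w * int b) mod int m = (f b + P) mod int m" by (simp add: cong_def)
      also have "\<dots> = (f b + P - int m) mod int m" by simp
      also have "\<dots> = f b + P - int m"
        using P f[of b] fb W by (intro mod_pos_pos_trivial) auto
      finally have "(int w * int b) mod int m \<ge> int W" using P fb W by auto
      thus False using b by (simp add: D_def mod_mult_right_eq)
    qed
  qed
  moreover have "0 \<in> D" using W by (simp add: D_def)
  \<comment> \<open>\<open>w\<close> sends \<open>j - i\<close> to \<open>W\<close>, the first point
    after the arc that defines \<open>D\<close>.\<close>
  moreover have "j - i \<notin> D"
  proof -
    have "(int w * int (j - i)) mod int m = int W mod int m"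
      using w1 by (metis cong_def cong_int_iff of_nat_mult)
    also have "\<dots> = int W" using W by simp
    finally show ?thesis by (simp add: D_def mod_mult_right_eq)
  qed
  moreover have "T \<subseteq> {..<m}" by (auto simp: T_def)
  ultimately show ?thesis using ij by (intro exI[of _ D] exI[of _ T]) (auto simp: subset_iff)
qed

lemma cong_mult_both_iff:
  "(e :: nat) > 0 \<Longrightarrow> [e * a = e * b] (mod (e * n)) \<longleftrightarrow> [a = b] (mod n)"
  by (simp add: cong_def)

text \<open>The required \<open>w\<close> is only determined modulo \<open>m / e\<close>. Changing it moves \<open>w i mod m\<close> in steps of
  \<open>(m / e) gcd(i, e)\<close>, and these are at most \<open>m / 3\<close> because \<open>e\<close> is odd and does not divide \<open>i\<close>.\<close>

lemma glynn_sets_not_dvd: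
  fixes m i j :: nat
  assumes "odd m" and ij: "i < j" "j < m" and ndvd: "\<not> gcd (j - i) m dvd i"
  shows "\<exists>D T. D \<subseteq> T \<and> T \<subseteq> {..<m} \<and> D \<noteq> {} \<and> D \<noteq> {..<m} \<and>
    [(2 ^ i + 2 ^ j) * set_encode D = set_encode T] (mod (2 ^ m - 1))"
proof -
  define e where "e = gcd (j - i) m"
  have e0: "e > 0" using ij by (simp add: e_def)
  obtain k n where kn: "j - i = e * k" "m = e * n" "coprime k n"
    unfolding e_def using ij gcd_coprime_exists[of "j - i" m] by (auto simp: mult.commute)
  have odds: "odd e" "odd n" using assms(1) kn(2) by auto
  \<comment> \<open>Otherwise \<open>m\<close> would divide \<open>j - i\<close>, which lies
    strictly between 0 and \<open>m\<close>.\<close>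
  have "n \<noteq> 1" using kn ij by (cases k) auto
  with odds obtain h where h: "n = 2 * h + 1" "h > 0" by (auto elim!: oddE)
  have n0: "n > 0" using h by simp
  define W where "W = e * h"
  have W: "m = 2 * W + e" "W > 0" using h kn e0 by (auto simp: W_def algebra_simps)
  obtain x where x: "[k * x = 1] (mod n)" using cong_solve_coprime_nat[OF kn(3)] by auto
  \<comment> \<open>One solution of \<open>w * k = h\<close> modulo \<open>n\<close>; adding
    multiples of \<open>n\<close> gives the others.\<close>
  define w0 where "w0 = x * h"
  define g where "g = gcd i e"
  have g: "g dvd e" "g > 0" using e0 by (simp_all add: g_def)
  have "g dvd i" by (simp add: g_def)
  hence g_neq: "g \<noteq> e" using ndvd by (auto simp: e_def)
  have "3 * g \<le> e"
  proof -
    obtain c where c: "e = g * c" using g by auto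
    have "c \<noteq> 0" "c \<noteq> 1" "odd c" using c g g_neq e0 odds by auto
    hence "c \<ge> 3" by presburger
    thus ?thesis using c by simp
  qed
  hence ng: "n * g \<le> W"
  proof -
    have "n * g \<le> 3 * h * g" using h by simp
    also have "\<dots> = h * (3 * g)" by simp
    also have "\<dots> \<le> h * e" using \<open>3 * g \<le> e\<close> by (intro mult_left_mono) auto
    finally show ?thesis by (simp add: W_def mult.commute)
  qed
  \<comment> \<open>The target \<open>W + e\<close> is raised by a multiple of \<open>m\<close> to
    be at least \<open>w0 * i\<close>, so that subtraction does not truncate. Then \<open>t\<close>
    is the least number of steps of length \<open>n * g\<close> reaching it, and the overshoot stays
    below \<open>n * g \<le> W\<close>.\<close>
  define T where "T = W + e + m * (w0 * i)"
  define s where "s = T - w0 * i + n * g - 1"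
  define t where "t = s div (n * g)"
  have ng0: "n * g > 0" using g h by simp
  have T: "w0 * i \<le> T" using W e0 by (simp add: T_def trans_le_add2)
  have t: "T \<le> w0 * i + n * g * t" "w0 * i + n * g * t < T + n * g"
  proof -
    have "s = n * g * t + s mod (n * g)" by (simp add: t_def)
    moreover have "s mod (n * g) < n * g" using ng0 by simp
    ultimately show "T \<le> w0 * i + n * g * t" "w0 * i + n * g * t < T + n * g"
      using T ng0 s_def by linarith+
  qed
  \<comment> \<open>Adding \<open>n * y\<close> to the multiplier moves its product with
    \<open>i\<close> by \<open>n * g\<close> modulo \<open>m\<close>.\<close>
  obtain y where y: "[i * y = g] (mod e)"
    unfolding g_def using cong_solve_nat[of i e] by auto
  define w where "w = w0 + n * (y * t)"
  have "[w * k = h] (mod n)"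
  proof -
    have "[w * k = (k * x) * h + n * (y * t * k)] (mod n)" by (simp add: w_def w0_def algebra_simps)
    also have "[(k * x) * h + n * (y * t * k) = 1 * h + 0] (mod n)"
      by (intro cong_add cong_mult x cong_refl) (simp add: cong_def)
    finally show ?thesis by simp
  qed
  hence "[w * (j - i) = W] (mod m)"
    unfolding kn W_def using e0 by (simp add: mult.left_commute[of w e k] cong_mult_both_iff)
  moreover have "(w * i) mod m \<ge> W + e"
  proof -
    have "[n * (i * y * t) = n * (g * t)] (mod m)"
    proof -
      have "[i * y * t = g * t] (mod e)" using y by (intro cong_mult cong_refl)
      thus ?thesis unfolding kn mult.commute[of e n] using n0 by (simp add: cong_mult_both_iff)
    qed
    hence "[w0 * i + n * (i * y * t) = w0 * i + n * (g * t)] (mod m)" by (intro cong_add cong_refl)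
    moreover have "w * i = w0 * i + n * (i * y * t)" by (simp add: w_def algebra_simps)
    ultimately have "(w * i) mod m = (w0 * i + n * g * t) mod m" by (simp add: cong_def algebra_simps)
    also have "w0 * i + n * g * t = (w0 * i + n * g * t - m * (w0 * i)) + m * (w0 * i)"
      using t by (simp add: T_def)
    also have "\<dots> mod m = (w0 * i + n * g * t - m * (w0 * i)) mod m" by simp
    also have "\<dots> = w0 * i + n * g * t - m * (w0 * i)"
      using t ng W by (intro mod_less) (simp add: T_def)
    finally show ?thesis using t by (simp add: T_def)
  qed
  ultimately show ?thesis using glynn_sets_interval[OF ij W] by blast
qed

text \<open>For \<open>x = 2 ^ (j - i)\<close> the first factor is what remains of
  \<open>2 ^ i + 2 ^ j\<close> once \<open>2 ^ i\<close> is taken out.\<close>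

lemma sum_power_pairs: "(x + 1) * (\<Sum>t<h. x ^ (2 * t)) = (\<Sum>t<2 * h. x ^ t :: nat)"
  by (induction h) (simp_all add: algebra_simps)

text \<open>Here \<open>i \<equiv> B \<kappa>\<close> modulo \<open>m\<close>, and \<open>D\<close> consists of the even multiples of \<open>\<kappa>\<close>. Its two shifts cover all
  multiples of \<open>e\<close> but one if \<open>B\<close> is even. If \<open>B\<close> is odd, \<open>D\<close> has one more element and the shifts
  overlap at \<open>i\<close>; the carry goes to \<open>i + 1\<close>, which is not a multiple of \<open>e\<close>.\<close>

lemma glynn_sets_dvd:
  fixes m i j :: nat
  assumes "odd m" and ij: "i < j" "j < m" and dvd: "gcd (j - i) m dvd i" and gt: "gcd (j - i) m > 1"
  shows "\<exists>D T. D \<subseteq> T \<and> T \<subseteq> {..<m} \<and> D \<noteq> {} \<and> D \<noteq> {..<m} \<and>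
    [(2 ^ i + 2 ^ j) * set_encode D = set_encode T] (mod (2 ^ m - 1))"
proof -
  define e where "e = gcd (j - i) m"
  have e1: "e > 1" using gt by (simp add: e_def)
  obtain k n where kn: "j - i = e * k" "m = e * n" "coprime k n"
    unfolding e_def using ij gcd_coprime_exists[of "j - i" m] by (auto simp: mult.commute)
  have odds: "odd e" "odd n" using assms(1) kn(2) by auto
  have "n \<noteq> 1" using kn ij by (cases k) auto
  with odds(2) have n3: "n \<ge> 3" by presburger
  have m0: "m > 0" using ij by simp
  obtain i' where i': "i = e * i'" using dvd by (auto simp: e_def)
  obtain x where x: "[k * x = 1] (mod n)" using cong_solve_coprime_nat[OF kn(3)] by auto
  define B where "B = (x * i') mod n"
  have B: "B < n" using n3 by (simp add: B_def)
  have "[B * k = (k * x) * i'] (mod n)"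
    by (simp add: B_def cong_def mod_mult_left_eq mult.assoc mult.commute[of k])
  also have "[(k * x) * i' = 1 * i'] (mod n)" by (intro cong_mult x cong_refl)
  finally have "[B * (e * k) = e * i'] (mod (e * n))"
    using e1 by (simp add: cong_mult_both_iff mult.left_commute[of B e k])
  hence Bi: "[B * (j - i) = i] (mod m)"
    by (simp only: kn(1)[symmetric] kn(2)[symmetric] i'[symmetric])
  have e_dvd: "e dvd i" "e dvd j - i" "e dvd m" using dvd by (simp_all add: e_def)
  have cong_iff: "[t * (j - i) = s * (j - i)] (mod m) \<longleftrightarrow> [t = s] (mod n)" for t s
  proof -
    have "[t * (j - i) = s * (j - i)] (mod m) \<longleftrightarrow> [e * (t * k) = e * (s * k)] (mod (e * n))"
      by (simp add: kn mult.left_commute[of _ e k])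
    also have "\<dots> \<longleftrightarrow> [t = s] (mod n)"
      using e1 kn(3) by (simp add: cong_mult_both_iff cong_mult_rcancel_nat)
    finally show ?thesis .
  qed
  define E where "E = {a. a < m \<and> e dvd a}"
  have inj: "inj_on (\<lambda>t. (t * (j - i) + i) mod m) {..<n}"
  proof (rule inj_onI)
    fix s t assume st: "s \<in> {..<n}" "t \<in> {..<n}"
      "(s * (j - i) + i) mod m = (t * (j - i) + i) mod m"
    hence "[s * (j - i) = t * (j - i)] (mod m)" by (simp add: cong_def[symmetric] cong_add_rcancel_nat)
    hence "[s = t] (mod n)" by (simp add: cong_iff)
    thus "s = t" using st by (auto simp: cong_def)
  qed
  \<comment> \<open>\<open>j - i\<close> generates the group of multiples of \<open>e\<close> modulo
    \<open>m\<close>, which has order \<open>n\<close> and contains \<open>i\<close>.\<close>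
  have img: "(\<lambda>t. (t * (j - i) + i) mod m) ` {..<n} = E"
  proof (rule card_subset_eq)
    show "finite E" by (simp add: E_def)
    show "(\<lambda>t. (t * (j - i) + i) mod m) ` {..<n} \<subseteq> E"
      using m0 e_dvd by (auto simp: E_def dvd_mod)
    have "E = (\<lambda>t. e * t) ` {..<n}" using e1 by (auto simp: E_def kn)
    hence "card E = n" using e1 by (simp add: card_image inj_on_def)
    thus "card ((\<lambda>t. (t * (j - i) + i) mod m) ` {..<n}) = card E"
      using inj by (simp add: card_image)
  qed
  define D where "D h = (\<lambda>t. (2 * t * (j - i)) mod m) ` {..<h}" for h
  \<comment> \<open>The bound keeps \<open>2 * t\<close> below \<open>n\<close> for
    \<open>t < h\<close>, so these multiples are distinct; it admits both lengths
    \<open>n - 1\<close> and \<open>n + 1\<close> used below.\<close>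
  have D_encode: "[(2 ^ i + 2 ^ j) * set_encode (D h) = (\<Sum>t<2 * h. 2 ^ (t * (j - i) + i))] (mod (2 ^ m - 1))"
    if "2 * h \<le> n + 1" for h
  proof -
    have "inj_on (\<lambda>t. (2 * t * (j - i)) mod m) {..<h}"
    proof (rule inj_onI)
      fix s t assume st: "s \<in> {..<h}" "t \<in> {..<h}" "(2 * s * (j - i)) mod m = (2 * t * (j - i)) mod m"
      hence "[2 * s = 2 * t] (mod n)" by (simp only: cong_def[symmetric] cong_iff)
      moreover have "2 * s < n" "2 * t < n" using st that by auto
      ultimately show "s = t" by (simp add: cong_def)
    qed
    hence "[set_encode (D h) = (\<Sum>t<h. 2 ^ (2 * t * (j - i)))] (mod (2 ^ m - 1))"
      unfolding D_def by (intro cong_sym[OF cong_sum_power2_set_encode])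
    hence "[(2 ^ i + 2 ^ j) * set_encode (D h) = (2 ^ i + 2 ^ j) * (\<Sum>t<h. 2 ^ (2 * t * (j - i)))] (mod (2 ^ m - 1))"
      by (intro cong_mult cong_refl)
    also have "(2 ^ i + 2 ^ j) * (\<Sum>t<h. 2 ^ (2 * t * (j - i))) =
        2 ^ i * ((2 ^ (j - i) + 1) * (\<Sum>t<h. (2 ^ (j - i)) ^ (2 * t) :: nat))"
    proof -
      have "2 ^ j = (2 :: nat) ^ i * 2 ^ (j - i)" using ij by (simp flip: power_add)
      thus ?thesis by (simp add: algebra_simps flip: power_mult)
    qed
    also have "\<dots> = (\<Sum>t<2 * h. 2 ^ (t * (j - i) + i))"
      unfolding sum_power_pairs
      by (simp add: sum_distrib_left power_add algebra_simps flip: power_mult)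
    finally show ?thesis .
  qed
  have D_sub: "D h \<subseteq> E" for h
    using m0 e_dvd by (auto simp: D_def E_def dvd_mod)
  have E_sub: "E \<subseteq> {..<m}" by (auto simp: E_def)
  show ?thesis
  proof (cases "even B")
    case True
    define h where "h = (n - 1) div 2"
    have h: "2 * h = n - 1" "h > 0" using odds n3 by (auto simp: h_def)
    hence hn: "2 * h \<le> n + 1" by simp
    define c where "c = ((n - 1) * (j - i) + i) mod m"
    \<comment> \<open>\<open>c\<close> is the multiple of \<open>j - i\<close> with index
      \<open>n - 1 + B\<close>. Modulo \<open>n\<close> this index is \<open>n - 1\<close>, too
      large for \<open>D h\<close>, or the odd number \<open>B - 1\<close>.\<close>
    have c: "c \<notin> D h"
    proof
      assume "c \<in> D h"
      then obtain t where t: "t < h" "c = (2 * t * (j - i)) mod m" by (auto simp: D_def)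
      have "[(n - 1 + B) * (j - i) = (n - 1) * (j - i) + i] (mod m)"
        unfolding add_mult_distrib using Bi by (intro cong_add cong_refl)
      also have "[(n - 1) * (j - i) + i = 2 * t * (j - i)] (mod m)"
        using t by (simp add: cong_def c_def)
      finally have "[n - 1 + B = 2 * t] (mod n)" by (simp only: cong_iff)
      hence *: "(n - 1 + B) mod n = 2 * t" using t h by (simp add: cong_def)
      show False
      proof (cases "B = 0")
        case True
        thus False using * t h n3 by simp
      next
        case False
        have "(n - 1 + B) mod n = (B - 1 + n) mod n" using False n3 by (simp add: algebra_simps)
        also have "\<dots> = B - 1" using B by simp
        finally have "B - 1 = 2 * t" using * by simp
        thus False using \<open>even B\<close> False by presburger
      qed
    qed
    have "{..<2 * h} = {..<n} - {n - 1}" using h n3 by auto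
    hence "(\<lambda>t. (t * (j - i) + i) mod m) ` {..<2 * h} = E - {c}"
      using inj n3 unfolding img[symmetric] c_def
      by (simp only:) (subst inj_on_image_set_diff[where C = "{..<n}"], auto)
    moreover have "[(\<Sum>t<2 * h. 2 ^ (t * (j - i) + i)) =
        set_encode ((\<lambda>t. (t * (j - i) + i) mod m) ` {..<2 * h})] (mod (2 ^ m - 1))"
      using h by (intro cong_sum_power2_set_encode inj_on_subset[OF inj]) auto
    ultimately have "[(\<Sum>t<2 * h. 2 ^ (t * (j - i) + i)) = set_encode (E - {c})] (mod (2 ^ m - 1))"
      by simp
    with D_encode[OF hn] have
      "[(2 ^ i + 2 ^ j) * set_encode (D h) = set_encode (E - {c})] (mod (2 ^ m - 1))"
      by (rule cong_trans)
    moreover have "D h \<noteq> {}" using h(2) by (simp add: D_def lessThan_empty_iff)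
    moreover have "c < m" using m0 by (simp add: c_def)
    hence "D h \<noteq> {..<m}" using c by blast
    moreover have "D h \<subseteq> E - {c}" using D_sub[of h] c by blast
    moreover have "E - {c} \<subseteq> {..<m}" using E_sub by blast
    ultimately show ?thesis by (intro exI[of _ "D h"] exI[of _ "E - {c}"] conjI)
  next
    case False
    define h where "h = (n + 1) div 2"
    have h: "2 * h = Suc n" "h > 0" using odds n3 by (auto simp: h_def)
    hence hn: "2 * h \<le> n + 1" by simp
    have c: "i \<notin> D h"
    proof
      assume "i \<in> D h"
      then obtain t where t: "t < h" "i = (2 * t * (j - i)) mod m" by (auto simp: D_def)
      have "[B * (j - i) = i] (mod m)" by (rule Bi)
      also have "[i = 2 * t * (j - i)] (mod m)" using t(2) by (metis cong_def mod_mod_trivial)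
      finally have "[B = 2 * t] (mod n)" by (simp only: cong_iff)
      hence "B = 2 * t" using t h B by (simp add: cong_def)
      thus False using False by simp
    qed
    define T where "T = insert (i + 1) (E - {i})"
    have iE: "i \<in> E" using ij e_dvd by (auto simp: E_def)
    have iE': "i + 1 \<notin> E" using e1 e_dvd by (auto simp: E_def dvd_add_right_iff simp del: One_nat_def)
    \<comment> \<open>Of the \<open>n + 1\<close> terms, the first \<open>n\<close> run through
      \<open>E\<close> and the last returns to \<open>i\<close>.\<close>
    have "[(\<Sum>t<2 * h. 2 ^ (t * (j - i) + i)) = set_encode E + 2 ^ i] (mod (2 ^ m - 1))"
    proof -
      have "[(\<Sum>t<n. 2 ^ (t * (j - i) + i)) + 2 ^ (n * (j - i) + i) = set_encode E + 2 ^ i] (mod (2 ^ m - 1))"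
      proof (rule cong_add)
        show "[(\<Sum>t<n. 2 ^ (t * (j - i) + i)) = set_encode E] (mod (2 ^ m - 1))"
          unfolding img[symmetric] by (rule cong_sum_power2_set_encode[OF inj])
        have "n * (j - i) = m * k" by (simp add: kn)
        hence "(n * (j - i) + i) mod m = i" using ij by simp
        thus "[2 ^ (n * (j - i) + i) = 2 ^ i] (mod (2 ^ m - 1 :: nat))"
          using cong_power2_mod[of "n * (j - i) + i" m] by (simp add: cong_sym)
      qed
      thus ?thesis by (simp add: h)
    qed
    also have "set_encode E + 2 ^ i = set_encode T"
    proof -
      have "finite E" by (simp add: E_def)
      hence "set_encode E = 2 ^ i + set_encode (E - {i})" "set_encode T = 2 ^ (i + 1) + set_encode (E - {i})"
        using iE iE' by (simp_all add: set_encode_def T_def sum.remove)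
      thus ?thesis by simp
    qed
    finally have "[(\<Sum>t<2 * h. 2 ^ (t * (j - i) + i)) = set_encode T] (mod (2 ^ m - 1))" .
    with D_encode[OF hn] have "[(2 ^ i + 2 ^ j) * set_encode (D h) = set_encode T] (mod (2 ^ m - 1))"
      by (rule cong_trans)
    moreover have "D h \<noteq> {}" using h(2) by (simp add: D_def lessThan_empty_iff)
    moreover have "i < m" using ij by simp
    hence "D h \<noteq> {..<m}" using c by blast
    moreover have "D h \<subseteq> T" using D_sub[of h] c unfolding T_def by blast
    moreover have "T \<subseteq> {..<m}" using E_sub ij by (auto simp: T_def)
    ultimately show ?thesis by (intro exI[of _ "D h"] exI[of _ T] conjI)
  qed
qed

lemma glynn_sets_exist:
  fixes m i j :: nat
  assumes "odd m" "i < j" "j < m" "gcd (j - i) m \<noteq> 1"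
  shows "\<exists>D T. D \<subseteq> T \<and> T \<subseteq> {..<m} \<and> D \<noteq> {} \<and> D \<noteq> {..<m} \<and>
    [(2 ^ i + 2 ^ j) * set_encode D = set_encode T] (mod (2 ^ m - 1))"
proof (cases "gcd (j - i) m dvd i")
  case True
  have "gcd (j - i) m > 1" using assms by (metis gcd_eq_0_iff less_one linorder_neqE_nat not_less0)
  thus ?thesis using glynn_sets_dvd assms True by blast
qed (use glynn_sets_not_dvd assms in blast)

text \<open>The codes lie between 0 and \<open>2 ^ m - 1\<close>, where only the two endpoints are
  distinct and congruent; they encode the empty and the full set.\<close>

lemma set_encode_cong_imp_eq:
  assumes "V \<subseteq> {..<m}" "R \<subseteq> {..<m}" "[set_encode V = set_encode R] (mod (2 ^ m - 1))"
    and "\<not> (V = {} \<and> R = {..<m})" "\<not> (V = {..<m} \<and> R = {})"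
  shows "V = R"
proof -
  have fin: "finite V" "finite R" using assms finite_subset by blast+
  have le: "set_encode V \<le> 2 ^ m - 1" "set_encode R \<le> 2 ^ m - 1"
    unfolding set_encode_lessThan[symmetric] set_encode_def
    using assms(1,2) by (auto intro!: sum_mono2)
  have empty: "S = {}" if "set_encode S = 0" "finite S" for S
    using that set_encode_eq[of S "{}"] by simp
  have full: "S = {..<m}" if "set_encode S = 2 ^ m - 1" "finite S" for S
    using that set_encode_eq[of S "{..<m}"] by (simp add: set_encode_lessThan)
  have "set_encode V = set_encode R \<or> set_encode V = 0 \<and> set_encode R = 2 ^ m - 1 \<or>
      set_encode V = 2 ^ m - 1 \<and> set_encode R = 0"
    using assms(3) le
    by (cases "set_encode V = 2 ^ m - 1"; cases "set_encode R = 2 ^ m - 1") (auto simp: cong_def)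
  thus ?thesis using assms(4,5) empty full fin set_encode_eq by metis
qed

section \<open>Binary finite fields and the trace character\<close>

text \<open>The canonical additive character, integer-valued so that its sums can be compared with
  cardinalities.\<close>

definition trace_char :: "nat \<Rightarrow> 'a::field \<Rightarrow> int" where
  "trace_char m x = (if abs_trace m x = 0 then 1 else -1)"

definition gold_map :: "nat \<Rightarrow> nat \<Rightarrow> 'a::field \<Rightarrow> 'a" where
  "gold_map i j x = x ^ (2 ^ i + 2 ^ j) + x"

definition walsh :: "nat \<Rightarrow> nat \<Rightarrow> nat \<Rightarrow> 'a::{field,finite} \<Rightarrow> int" where
  "walsh m i j a = (\<Sum>x\<in>UNIV. trace_char m (a * gold_map i j x))"

lemma sum_two_to_one_range:
  fixes f :: "'a::finite \<Rightarrow> 'b" and g :: "'b \<Rightarrow> int"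
  assumes "\<forall>y. card {x. f x = y} \<in> {0, 2}"
  shows "(\<Sum>x\<in>UNIV. g (f x)) = 2 * (\<Sum>y\<in>range f. g y)"
proof -
  have "(\<Sum>x\<in>UNIV. g (f x)) = (\<Sum>y\<in>range f. \<Sum>x\<in>{x \<in> UNIV. f x = y}. g (f x))"
    by (rule sum.image_gen) simp
  also have "\<dots> = (\<Sum>y\<in>range f. 2 * g y)"
  proof (intro sum.cong refl)
    fix y assume "y \<in> range f"
    hence "card {x. f x = y} \<noteq> 0" by auto
    hence "card {x. f x = y} = 2" using spec[OF assms, of y] by auto
    thus "(\<Sum>x\<in>{x \<in> UNIV. f x = y}. g (f x)) = 2 * g y" by simp
  qed
  finally show ?thesis by (simp add: sum_distrib_left)
qed

lemma power_set_encode: "finite V \<Longrightarrow> (x :: 'a::comm_monoid_mult) ^ set_encode V = (\<Prod>a\<in>V. x ^ (2 ^ a))"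
  unfolding set_encode_def by (simp add: power_sum)

context
  fixes m :: nat
  assumes card_UNIV_eq: "card (UNIV :: 'a::{field,finite} set) = 2 ^ m"
begin

section \<open>Characteristic two and the multiplicative group\<close>

lemma CHAR_eq_2: "CHAR('a) = 2"
proof -
  have "prime CHAR('a)"
    by (rule prime_CHAR_semidom) (simp add: finite_imp_CHAR_pos)
  moreover have "CHAR('a) dvd 2 ^ m"
    using CHAR_dvd_CARD[where 'a = 'a] by (simp add: card_UNIV_eq)
  ultimately show ?thesis
    using prime_dvd_power primes_dvd_imp_eq two_is_prime_nat by blast
qed

lemma add_self: "x + x = (0 :: 'a)"
  using uminus_CHAR_2[OF CHAR_eq_2, of x] by (metis add.right_inverse)

lemma add_eq_0_iff_eq: "x + y = (0 :: 'a) \<longleftrightarrow> x = y"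
  using minus_CHAR_2[OF CHAR_eq_2, of x y] by (metis right_minus_eq)

lemma frobenius_add: "(x + y :: 'a) ^ (2 ^ k) = x ^ (2 ^ k) + y ^ (2 ^ k)"
  by (rule freshmans_dream'[where n = k]) (simp_all add: CHAR_eq_2)

lemma frobenius_sum: "(sum f A :: 'a) ^ (2 ^ k) = (\<Sum>x\<in>A. f x ^ (2 ^ k))"
  by (rule freshmans_dream_sum'[where n = k]) (simp_all add: CHAR_eq_2)

lemma m_pos: "m > 0"
proof (rule ccontr)
  assume "\<not> m > 0"
  hence "card (UNIV :: 'a set) = 1" using card_UNIV_eq by simp
  moreover have "card {0, 1 :: 'a} \<le> card (UNIV :: 'a set)" by (intro card_mono) auto
  ultimately show False by simp
qed

lemma card_nonzero: "card (UNIV - {0 :: 'a}) = 2 ^ m - 1"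
  by (simp add: card_Diff_subset card_UNIV_eq)

text \<open>Multiplication by \<open>x\<close> permutes the nonzero elements, so it preserves their
  product.\<close>

lemma power_order_eq_1:
  assumes "(x :: 'a) \<noteq> 0"
  shows "x ^ (2 ^ m - 1) = 1"
proof -
  let ?S = "UNIV - {0 :: 'a}"
  have "(\<Prod>y\<in>?S. x * y) = (\<Prod>y\<in>?S. y)"
    by (rule prod.reindex_bij_witness[of _ "\<lambda>y. y / x" "\<lambda>y. x * y"]) (use assms in auto)
  hence "x ^ card ?S * (\<Prod>y\<in>?S. y) = 1 * (\<Prod>y\<in>?S. y)"
    by (simp add: prod.distrib)
  moreover have "(\<Prod>y\<in>?S. y) \<noteq> 0" by simp
  ultimately show ?thesis by (simp add: card_nonzero)
qed

lemma power_card_eq: "(x :: 'a) ^ (2 ^ m) = x"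
proof (cases "x = 0")
  case False
  have "x ^ (2 ^ m) = x ^ Suc (2 ^ m - 1)" by simp
  also have "\<dots> = x" unfolding power_Suc power_order_eq_1[OF False] by simp
  finally show ?thesis .
qed simp

lemma power_eq_1_if_dvd:
  assumes "(x :: 'a) \<noteq> 0" "(2 ^ m - 1) dvd k"
  shows "x ^ k = 1"
  using assms power_order_eq_1[of x] by (auto elim: dvdE simp: power_mult)

lemma power_cong_exponent:
  assumes "(x :: 'a) \<noteq> 0" "[k = l] (mod (2 ^ m - 1))"
  shows "x ^ k = x ^ l"
proof -
  have *: "x ^ k = x ^ (k mod (2 ^ m - 1))" for k
  proof -
    have "x ^ k = x ^ ((2 ^ m - 1) * (k div (2 ^ m - 1)) + k mod (2 ^ m - 1))" by simp
    also have "\<dots> = x ^ (k mod (2 ^ m - 1))"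
      unfolding power_add power_mult using power_order_eq_1[OF assms(1)] by simp
    finally show ?thesis .
  qed
  show ?thesis using *[of k] *[of l] assms(2) by (simp add: cong_def)
qed

lemma power_frobenius_mod: "(x :: 'a) ^ (2 ^ (k mod m)) = x ^ (2 ^ k)"
proof -
  have *: "x ^ (2 ^ (m * t)) = x" for t
  proof (induction t)
    case (Suc t)
    have "x ^ (2 ^ (m * Suc t)) = (x ^ (2 ^ (m * t))) ^ (2 ^ m)"
      by (simp add: power_add power_mult[symmetric] mult.commute)
    thus ?case using Suc by (simp add: power_card_eq)
  qed simp
  have "x ^ (2 ^ k) = x ^ (2 ^ (m * (k div m) + k mod m))" by simp
  also have "\<dots> = (x ^ (2 ^ (m * (k div m)))) ^ (2 ^ (k mod m))"
    unfolding power_add power_mult ..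
  finally show ?thesis by (simp add: *)
qed

text \<open>Otherwise the polynomial \<open>monom 1 r - 1\<close>, with \<open>r\<close> the residue
  of \<open>k\<close>, would have more than \<open>r\<close> roots. This serves in place of a
  primitive element.\<close>

lemma exists_power_neq_1:
  assumes "\<not> (2 ^ m - 1) dvd k"
  obtains g :: 'a where "g \<noteq> 0" "g ^ k \<noteq> 1"
proof -
  define r where "r = k mod (2 ^ m - 1)"
  have r: "r > 0" "r < 2 ^ m - 1"
  proof -
    show "r > 0" using assms by (simp add: r_def mod_greater_zero_iff_not_dvd)
    have "(2::nat) ^ m \<ge> 2 ^ 1" by (rule power_increasing) (use m_pos in auto)
    thus "r < 2 ^ m - 1" unfolding r_def by (intro mod_less_divisor) simp
  qed
  have "\<exists>g. g \<noteq> 0 \<and> g ^ r \<noteq> (1 :: 'a)"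
  proof (rule ccontr)
    assume "\<not> ?thesis"
    hence "UNIV - {0} \<subseteq> {x. poly (monom 1 r - 1 :: 'a poly) x = 0}"
      by (auto simp: poly_monom)
    moreover have nz: "(monom 1 r - 1 :: 'a poly) \<noteq> 0"
    proof
      assume "(monom 1 r - 1 :: 'a poly) = 0"
      hence "coeff (monom 1 r - 1 :: 'a poly) r = 0" by simp
      thus False using r by simp
    qed
    ultimately have "2 ^ m - 1 \<le> card {x. poly (monom 1 r - 1 :: 'a poly) x = 0}"
      using card_mono[of "{x. poly (monom 1 r - 1 :: 'a poly) x = 0}" "UNIV - {0}"]
      by (simp add: card_nonzero)
    also have "\<dots> \<le> degree (monom 1 r - 1 :: 'a poly)"
      by (rule card_poly_roots_bound) (rule nz)
    also have "\<dots> \<le> r" by (rule degree_diff_le) (auto simp: degree_monom_le)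
    finally show False using r by simp
  qed
  then obtain g :: 'a where g: "g \<noteq> 0" "g ^ r \<noteq> 1" by blast
  moreover have "g ^ k = g ^ r"
    by (rule power_cong_exponent) (use g in \<open>auto simp: r_def cong_def\<close>)
  ultimately show ?thesis using that by auto
qed

text \<open>Scaling by \<open>g\<close> with \<open>g ^ k \<noteq> 1\<close> multiplies the sum by
  \<open>g ^ k\<close>, forcing it to vanish; otherwise an odd number of ones is added in
  characteristic two.\<close>

lemma sum_nonzero_power:
  "(\<Sum>x\<in>UNIV - {0 :: 'a}. x ^ k) = (if (2 ^ m - 1) dvd k then 1 else 0)"
proof (cases "(2 ^ m - 1) dvd k")
  case True
  have "(\<Sum>x\<in>UNIV - {0 :: 'a}. x ^ k) = of_nat (2 ^ m - 1)"
    using True by (simp add: power_eq_1_if_dvd card_nonzero)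
  also have "\<dots> = 1"
  proof -
    have "odd (2 ^ m - 1 :: nat)" using m_pos by simp
    then obtain t where "2 ^ m - 1 = 2 * t + (1 :: nat)" by (elim oddE)
    moreover have "(of_nat 2 :: 'a) = 0" using of_nat_CHAR[where 'a = 'a] by (simp add: CHAR_eq_2)
    ultimately show ?thesis by (metis add_0 mult_zero_left of_nat_1 of_nat_add of_nat_mult)
  qed
  finally show ?thesis using True by simp
next
  case False
  then obtain g :: 'a where g: "g \<noteq> 0" "g ^ k \<noteq> 1" by (rule exists_power_neq_1)
  have "(\<Sum>x\<in>UNIV - {0 :: 'a}. x ^ k) = (\<Sum>x\<in>UNIV - {0}. (g * x) ^ k)"
    by (rule sum.reindex_bij_witness[of _ "\<lambda>y. g * y" "\<lambda>y. y / g"]) (use g in auto)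
  also have "\<dots> = g ^ k * (\<Sum>x\<in>UNIV - {0 :: 'a}. x ^ k)"
    by (simp add: power_mult_distrib sum_distrib_left)
  finally show ?thesis using g False by simp
qed

section \<open>The absolute trace and its additive character\<close>

lemma abs_trace_add: "abs_trace m (x + y :: 'a) = abs_trace m x + abs_trace m y"
  by (simp add: abs_trace_def frobenius_add sum.distrib)

lemma abs_trace_0 [simp]: "abs_trace m (0 :: 'a) = 0"
  by (simp add: abs_trace_def power_0_left)

lemma abs_trace_square: "abs_trace m (x ^ 2 :: 'a) = abs_trace m x"
proof -
  have "abs_trace m (x ^ 2) = (\<Sum>k<m. x ^ (2 ^ Suc k))"
    by (simp add: abs_trace_def power_mult[symmetric])
  also have "\<dots> = abs_trace m x"
    using sum.lessThan_Suc_shift[of "\<lambda>k. x ^ (2 ^ k)" m]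
      sum.lessThan_Suc[of "\<lambda>k. x ^ (2 ^ k)" m]
    by (simp add: power_card_eq abs_trace_def add.commute)
  finally show ?thesis .
qed

lemma abs_trace_frobenius: "abs_trace m (x ^ (2 ^ k) :: 'a) = abs_trace m x"
proof (induction k)
  case (Suc k)
  have "x ^ (2 ^ Suc k) = (x ^ (2 ^ k)) ^ 2" by (simp add: power_mult[symmetric] mult.commute)
  thus ?case using Suc by (simp only: abs_trace_square)
qed simp

text \<open>The trace is fixed by squaring, hence is idempotent.\<close>

lemma abs_trace_cases: "abs_trace m (x :: 'a) = 0 \<or> abs_trace m x = 1"
proof -
  have "abs_trace m x ^ 2 ^ 1 = abs_trace m (x ^ 2)"
    unfolding abs_trace_def frobenius_sum by (simp add: power_mult[symmetric] mult.commute)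
  hence "abs_trace m x * abs_trace m x = abs_trace m x"
    unfolding abs_trace_square by (simp add: power2_eq_square)
  hence "abs_trace m x * (abs_trace m x - 1) = 0"
    by (simp add: right_diff_distrib)
  thus ?thesis by simp
qed

text \<open>The trace is a nonzero polynomial of degree at most \<open>2 ^ (m - 1)\<close>, too
  small to vanish on the whole field.\<close>

lemma abs_trace_nonzero: "\<exists>x :: 'a. abs_trace m x \<noteq> 0"
proof (rule ccontr)
  assume "\<not> ?thesis"
  hence *: "abs_trace m x = 0" for x :: 'a by simp
  define p :: "'a poly" where "p = (\<Sum>k<m. monom 1 (2 ^ k))"
  have p: "poly p x = abs_trace m x" for x
    by (simp add: p_def poly_sum poly_monom abs_trace_def)
  have "coeff p 1 = (\<Sum>k<m. if k = 0 then 1 else 0)"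
    unfolding p_def coeff_sum by (intro sum.cong) auto
  hence nz: "p \<noteq> 0" using m_pos by auto
  have "degree p \<le> 2 ^ (m - 1)"
    unfolding p_def
    by (intro degree_sum_le) (auto intro!: order.trans[OF degree_monom_le] power_increasing)
  moreover have "card {x. poly p x = 0} \<le> degree p" by (rule card_poly_roots_bound[OF nz])
  moreover have "{x. poly p x = 0} = UNIV" by (simp add: p *)
  ultimately have "(2::nat) ^ m \<le> 2 ^ (m - 1)" using card_UNIV_eq by (metis order.trans)
  thus False using m_pos by (simp add: power_le_imp_le_exp)
qed

lemma trace_char_0 [simp]: "trace_char m (0 :: 'a) = 1"
  by (simp add: trace_char_def)

lemma trace_char_add: "trace_char m (x + y :: 'a) = trace_char m x * trace_char m y"
  using abs_trace_cases[of x] abs_trace_cases[of y]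
  by (auto simp: trace_char_def abs_trace_add add_self)

lemma trace_char_frobenius: "trace_char m (x ^ (2 ^ k) :: 'a) = trace_char m x"
  by (simp add: trace_char_def abs_trace_frobenius)

text \<open>Translating by a point with nontrivial character value multiplies the sum by that
  value.\<close>

lemma sum_trace_char_linear:
  assumes add: "\<And>x y :: 'a. L (x + y) = L x + (L y :: 'a)" and "\<exists>x. trace_char m (L x) \<noteq> 1"
  shows "(\<Sum>x\<in>UNIV. trace_char m (L x)) = 0"
proof -
  obtain z where z: "trace_char m (L z) \<noteq> 1" using assms by blast
  have "(\<Sum>x\<in>UNIV. trace_char m (L x)) = (\<Sum>x\<in>UNIV. trace_char m (L (z + x)))"
    by (rule sum.reindex_bij_witness[of _ "\<lambda>y. z + y" "\<lambda>y. y - z"]) auto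
  also have "\<dots> = trace_char m (L z) * (\<Sum>x\<in>UNIV. trace_char m (L x))"
    by (simp add: add trace_char_add sum_distrib_left)
  finally show ?thesis using z by simp
qed

lemma sum_trace_char:
  "(\<Sum>x\<in>(UNIV :: 'a set). trace_char m (a * x)) = (if a = 0 then 2 ^ m else 0)"
proof (cases "a = 0")
  case False
  obtain z where z: "abs_trace m (z :: 'a) \<noteq> 0" using abs_trace_nonzero by blast
  have "trace_char m (a * (z / a)) \<noteq> 1" using False z by (simp add: trace_char_def)
  hence "\<exists>x. trace_char m (a * x) \<noteq> 1" by blast
  hence "(\<Sum>x\<in>UNIV. trace_char m (a * x)) = 0"
    by (intro sum_trace_char_linear) (auto simp: distrib_left)
  thus ?thesis using False by simp
qed (simp add: card_UNIV_eq)

section \<open>Glynn's criterion\<close>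

text \<open>Every value is taken an even number of times, and even numbers are zero in the
  field.\<close>

lemma sum_two_to_one:
  fixes f :: "'a \<Rightarrow> 'a" and g :: "'a \<Rightarrow> 'a"
  assumes "\<forall>y. card {x. f x = y} \<in> {0, 2}"
  shows "(\<Sum>x\<in>UNIV. g (f x)) = 0"
proof -
  have two: "(of_nat 2 :: 'a) = 0"
    using of_nat_CHAR[where 'a = 'a] by (simp only: CHAR_eq_2)
  have "(\<Sum>x\<in>UNIV. g (f x)) = (\<Sum>y\<in>range f. \<Sum>x\<in>{x \<in> UNIV. f x = y}. g (f x))"
    by (rule sum.image_gen) simp
  also have "\<dots> = (\<Sum>y\<in>range f. of_nat (card {x. f x = y}) * g y)"
    by simp
  also have "\<dots> = 0"
  proof (intro sum.neutral ballI)
    fix y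
    have "card {x. f x = y} = 0 \<or> card {x. f x = y} = 2" using assms by blast
    hence "(of_nat (card {x. f x = y}) :: 'a) = 0" using two by (metis of_nat_0)
    thus "of_nat (card {x. f x = y}) * g y = 0" by simp
  qed
  finally show ?thesis .
qed

lemma two_to_one_fibre_0:
  assumes "\<forall>y::'a. card {x. x ^ r + x = y} \<in> {0, 2}" "r > 0"
  shows "{x :: 'a. x ^ r + x = 0} = {0, 1}"
proof -
  have "{0, 1} \<subseteq> {x :: 'a. x ^ r + x = 0}"
    using assms(2) by (auto simp: add_self)
  moreover have "card {x :: 'a. x ^ r + x = 0} \<le> card {0, 1 :: 'a}"
    using assms(1)[rule_format, of 0] by auto
  ultimately show ?thesis using card_seteq[of "{x :: 'a. x ^ r + x = 0}" "{0, 1}"] by simp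
qed

text \<open>If two nonzero elements had the same power, their quotient would lie in the fibre over 0
  and hence be 1; injectivity on a finite set gives surjectivity.\<close>

lemma two_to_one_power_surj:
  assumes "\<forall>y::'a. card {x. x ^ r + x = y} \<in> {0, 2}" "r > 0" "(y :: 'a) \<noteq> 0"
  obtains t where "t \<noteq> 0" "t ^ (r - 1) = y"
proof -
  have "inj_on (\<lambda>t :: 'a. t ^ (r - 1)) (UNIV - {0})"
  proof (rule inj_onI)
    fix s t :: 'a assume st: "s \<in> UNIV - {0}" "t \<in> UNIV - {0}" "s ^ (r - 1) = t ^ (r - 1)"
    hence "(s / t) ^ (r - 1) = 1" by (simp add: power_divide)
    hence "(s / t) ^ r = s / t" using assms(2) by (metis mult.right_neutral power_eq_if not_gr0)
    hence "s / t \<in> {x. x ^ r + x = 0}" by (simp add: add_self)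
    hence "s / t \<in> {0, 1}" using two_to_one_fibre_0[OF assms(1,2)] by simp
    thus "s = t" using st by simp
  qed
  hence "(\<lambda>t :: 'a. t ^ (r - 1)) ` (UNIV - {0}) = UNIV - {0}"
    by (intro endo_inj_surj) auto
  thus ?thesis using assms(3) that by (metis (no_types, lifting) DiffE UNIV_I DiffI imageE singleton_iff)
qed

text \<open>Rescaling \<open>x\<close> shows that \<open>x\<^sup>r + y x\<close> is two-to-one for every \<open>y \<noteq> 0\<close>, so all its power sums vanish.
  The coefficient at \<open>y\<close> to the power \<open>set_encode R\<close> of the power sum with exponent
  \<open>set_encode (D \<union> R)\<close>, where \<open>R\<close> is the complement of \<open>T\<close>, is nevertheless \<open>1\<close>.\<close>

lemma glynn_criterion:
  assumes two: "\<forall>y::'a. card {x. x ^ r + x = y} \<in> {0, 2}" and r: "r > 0"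
    and sets: "D \<subseteq> T" "T \<subseteq> {..<m}" "D \<noteq> {}" "D \<noteq> {..<m}"
    and cong: "[r * set_encode D = set_encode T] (mod (2 ^ m - 1))"
  shows False
proof -
  define R where "R = {..<m} - T"
  define U where "U = D \<union> R"
  define v where "v = set_encode"
  \<comment> \<open>The coefficient belonging to \<open>y ^ v V\<close> when the power sum of
    \<open>x ^ r + y * x\<close> with exponent \<open>v U\<close> is expanded digit by
    digit.\<close>
  define c where "c V = (\<Sum>x\<in>(UNIV :: 'a set). x ^ (v V + r * v (U - V)))" for V
  have fin: "finite D" "finite T" "finite R" "finite U"
    using sets(1,2) finite_subset[of _ "{..<m}"] by (simp_all add: R_def U_def)
  have U: "U \<subseteq> {..<m}" using sets by (auto simp: U_def R_def)
  have vR: "v R + v T = 2 ^ m - 1"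
  proof -
    have "v R + v T = v (R \<union> T)"
      unfolding v_def set_encode_def by (subst sum.union_disjoint) (auto simp: R_def fin)
    also have "R \<union> T = {..<m}" using sets by (auto simp: R_def)
    finally show ?thesis by (simp add: v_def set_encode_lessThan)
  qed
  have vanish: "(\<Sum>V\<in>Pow U. y ^ v V * c V) = 0" if y: "y \<noteq> 0" for y
  proof -
    obtain t where t: "t \<noteq> 0" "t ^ (r - 1) = y" using two_to_one_power_surj[OF two r y] .
    have tr: "y * t = t ^ r" using t r by (metis mult.commute power_eq_if not_gr0)
    have "(\<Sum>x\<in>UNIV. (x ^ r + y * x) ^ v U) = (\<Sum>x\<in>UNIV. ((t * x) ^ r + y * (t * x)) ^ v U)"
      by (rule sum.reindex_bij_witness[of _ "\<lambda>x. t * x" "\<lambda>x. x / t"]) (use t in auto)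
    also have "\<dots> = (\<Sum>x\<in>UNIV. (t ^ r * (x ^ r + x)) ^ v U)"
      by (simp add: power_mult_distrib distrib_left tr mult.assoc[symmetric])
    also have "\<dots> = 0"
      by (rule sum_two_to_one[OF two])
    finally have "0 = (\<Sum>x\<in>UNIV. (y * x + x ^ r) ^ v U)" by (simp add: add.commute)
    also have "\<dots> = (\<Sum>x\<in>UNIV. \<Sum>V\<in>Pow U. y ^ v V * x ^ (v V + r * v (U - V)))"
    proof (intro sum.cong refl)
      fix x
      have "(y * x + x ^ r) ^ v U = (\<Prod>a\<in>U. (y * x) ^ (2 ^ a) + (x ^ r) ^ (2 ^ a))"
        unfolding v_def power_set_encode[OF fin(4)] by (simp add: frobenius_add)
      also have "\<dots> = (\<Sum>V\<in>Pow U. (\<Prod>a\<in>V. (y * x) ^ (2 ^ a)) * (\<Prod>a\<in>U - V. (x ^ r) ^ (2 ^ a)))"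
        by (rule prod_add[OF fin(4)])
      also have "\<dots> = (\<Sum>V\<in>Pow U. y ^ v V * x ^ (v V + r * v (U - V)))"
      proof (intro sum.cong refl)
        fix V assume "V \<in> Pow U"
        hence V: "finite V" "finite (U - V)" using fin by (auto intro: finite_subset)
        show "(\<Prod>a\<in>V. (y * x) ^ (2 ^ a)) * (\<Prod>a\<in>U - V. (x ^ r) ^ (2 ^ a)) =
            y ^ v V * x ^ (v V + r * v (U - V))"
          unfolding power_set_encode[OF V(1), symmetric] power_set_encode[OF V(2), symmetric]
          by (simp add: v_def power_mult_distrib power_add power_mult)
      qed
      finally show "(y * x + x ^ r) ^ v U = \<dots>" .
    qed
    also have "\<dots> = (\<Sum>V\<in>Pow U. y ^ v V * c V)"
      unfolding c_def sum_distrib_left by (rule sum.swap)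
    finally show ?thesis by simp
  qed
  \<comment> \<open>Weighting by \<open>y ^ v T\<close> isolates one coefficient:
    \<open>v V + v T\<close> is divisible by \<open>2 ^ m - 1\<close> only for
    \<open>V = R\<close>.\<close>
  have "0 = (\<Sum>y\<in>UNIV - {0 :: 'a}. y ^ v T * (\<Sum>V\<in>Pow U. y ^ v V * c V))"
    using vanish by simp
  also have "\<dots> = (\<Sum>V\<in>Pow U. c V * (\<Sum>y\<in>UNIV - {0 :: 'a}. y ^ (v V + v T)))"
    unfolding sum_distrib_left by (subst sum.swap) (simp add: power_add algebra_simps)
  also have "\<dots> = (\<Sum>V\<in>Pow U. if V = R then c V else 0)"
  proof (intro sum.cong refl)
    fix V assume V: "V \<in> Pow U"
    have "(2 ^ m - 1) dvd (v V + v T) \<longleftrightarrow> V = R"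
    proof
      assume "V = R"
      thus "(2 ^ m - 1) dvd (v V + v T)" using vR by simp
    next
      assume "(2 ^ m - 1) dvd (v V + v T)"
      hence "[v V + v T = v R + v T] (mod (2 ^ m - 1))" by (simp add: vR cong_def)
      hence "[v V = v R] (mod (2 ^ m - 1))" by (simp add: cong_add_rcancel_nat)
      \<comment> \<open>A full \<open>R\<close> would make \<open>D\<close> empty; an empty
        \<open>R\<close> gives \<open>U = D\<close>, which a full \<open>V\<close> would make
        full.\<close>
      moreover have "\<not> (V = {} \<and> R = {..<m})" "\<not> (V = {..<m} \<and> R = {})"
        using sets V by (auto simp: U_def R_def)
      ultimately show "V = R"
        using V U set_encode_cong_imp_eq[of V m R] by (auto simp: v_def U_def R_def)
    qed
    thus "c V * (\<Sum>y\<in>UNIV - {0 :: 'a}. y ^ (v V + v T)) = (if V = R then c V else 0)"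
      by (simp add: sum_nonzero_power)
  qed
  also have "\<dots> = c R" using fin by (simp add: U_def)
  also have "c R = 1"
  proof -
    have "U - R = D" using sets by (auto simp: U_def R_def)
    have "v D > 0"
      using sets(3) fin(1) unfolding v_def set_encode_def by (simp add: sum_pos card_gt_0_iff)
    have "c R = (\<Sum>x\<in>UNIV - {0 :: 'a}. x ^ (v R + r * v D))"
      unfolding c_def \<open>U - R = D\<close> using r \<open>v D > 0\<close>
      by (intro sum.mono_neutral_right) (auto simp: power_0_left)
    also have "\<dots> = 1"
    proof -
      have "[v R + r * v D = v R + v T] (mod (2 ^ m - 1))"
        using cong by (intro cong_add cong_refl) (simp add: v_def)
      hence "(2 ^ m - 1) dvd (v R + r * v D)" using vR by (simp add: cong_0_iff[symmetric] cong_def)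
      thus ?thesis by (simp add: sum_nonzero_power)
    qed
    finally show ?thesis .
  qed
  finally show False by simp
qed

section \<open>Character sums of the two-to-one map\<close>

text \<open>For \<open>u\<close> inverse to \<open>k\<close> modulo \<open>m\<close>, iterating the
  given power map \<open>u\<close> times is squaring, so \<open>z * z = z\<close>.\<close>

lemma frobenius_fixed_imp_1:
  assumes "coprime k m" "(z :: 'a) ^ (2 ^ k) = z" "z \<noteq> 0"
  shows "z = 1"
proof -
  obtain u where u: "[k * u = 1] (mod m)" using cong_solve_coprime_nat[OF assms(1)] by auto
  have "z ^ (2 ^ (k * u)) = z"
  proof (induction u)
    case (Suc u)
    have "z ^ (2 ^ (k * Suc u)) = (z ^ (2 ^ k)) ^ (2 ^ (k * u))"
      by (simp add: power_add power_mult)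
    thus ?case using Suc assms by simp
  qed simp
  hence "z ^ (2 ^ (1 mod m)) = z"
    using u power_frobenius_mod[of z "k * u"] by (simp add: cong_def)
  hence "z * z = z * 1"
    using power_frobenius_mod[of z 1] by (simp add: power2_eq_square)
  thus ?thesis using assms(3) by simp
qed

text \<open>The inverse of \<open>r\<close> modulo the group order undoes the power map.\<close>

lemma unique_root_if_coprime:
  assumes "coprime r (2 ^ m - 1)" "(y :: 'a) \<noteq> 0"
  shows "\<exists>h. h \<noteq> 0 \<and> (\<forall>x. x ^ r = y \<and> x \<noteq> 0 \<longleftrightarrow> x = h)"
proof -
  obtain s where s: "[r * s = 1] (mod (2 ^ m - 1))" using cong_solve_coprime_nat[OF assms(1)] by auto
  have eq: "x ^ (r * s) = x" if "x \<noteq> 0" for x :: 'a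
    using power_cong_exponent[OF that s] by simp
  have 1: "(y ^ s) ^ r = y" using eq[OF assms(2)] by (simp add: power_mult[symmetric] mult.commute)
  have 2: "x = y ^ s" if "x ^ r = y" "x \<noteq> 0" for x
    using eq[OF that(2)] unfolding power_mult that(1) by (rule sym)
  have 3: "y ^ s \<noteq> 0" using assms(2) by simp
  show ?thesis
  proof (intro exI[of _ "y ^ s"] conjI allI iffI)
    fix x assume "x ^ r = y \<and> x \<noteq> 0"
    thus "x = y ^ s" using 2 by blast
  qed (simp_all only: 1 3 not_False_eq_True)
qed

context
  fixes i j :: nat
  assumes ij: "i < j" and jm: "j < m"
    and two: "\<forall>y :: 'a. card {x. gold_map i j x = y} \<in> {0, 2}"
begin

lemma fibre_0: "{x :: 'a. gold_map i j x = 0} = {0, 1}"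
  using two_to_one_fibre_0[of "2 ^ i + 2 ^ j"] two by (simp add: gold_map_def)

lemma card_fibre: "card {y :: 'a. gold_map i j x = gold_map i j y} = 2"
proof -
  have "{y :: 'a. gold_map i j x = gold_map i j y} = {y. gold_map i j y = gold_map i j x}" by auto
  moreover have "x \<in> {y. gold_map i j y = gold_map i j x}" by simp
  hence "card {y. gold_map i j y = gold_map i j x} \<noteq> 0" by (metis card_0_eq empty_iff finite)
  ultimately show ?thesis using spec[OF two, of "gold_map i j x"] by auto
qed

lemma coprime_diff_exponents:
  assumes "odd m"
  shows "coprime (j - i) m"
proof (rule ccontr)
  assume "\<not> coprime (j - i) m"
  hence "gcd (j - i) m \<noteq> 1" by (metis coprime_iff_gcd_eq_1)
  from glynn_sets_exist[OF assms ij jm this] obtain D T where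
    DT: "D \<subseteq> T" "T \<subseteq> {..<m}" "D \<noteq> {}" "D \<noteq> {..<m}"
    "[(2 ^ i + 2 ^ j) * set_encode D = set_encode T] (mod (2 ^ m - 1))"
    by (elim exE conjE)
  have "2 ^ i + 2 ^ j > (0 :: nat)" by simp
  from glynn_criterion[OF two[unfolded gold_map_def] this DT] show False .
qed

text \<open>The value 0, left out of \<open>D\<close>, contributes 1 to the sum over the image and
  offsets the \<open>- 1\<close> in the size of \<open>D\<close>.\<close>

lemma walsh_weight:
  fixes a :: 'a and D :: "'a set"
  defines "D \<equiv> range (gold_map i j) - {0}"
  shows "int (card D) = 2 ^ (m - 1) - 1"
    and "4 * int (hweight D (codeword m D a)) = 2 ^ m - walsh m i j a"
proof -
  have m: "m > 0" using jm by simp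
  have "gold_map i j 0 = (0 :: 'a)" by (simp add: gold_map_def)
  hence "0 \<in> range (gold_map i j :: 'a \<Rightarrow> 'a)" by (metis rangeI)
  hence insert: "range (gold_map i j) = insert 0 D" by (auto simp: D_def)
  have zero_notin: "0 \<notin> D" by (simp add: D_def)
  have "2 * int (card (range (gold_map i j :: 'a \<Rightarrow> 'a))) = 2 ^ m"
    using sum_two_to_one_range[OF two, of "\<lambda>_. 1"] by (simp add: card_UNIV_eq)
  hence card2: "2 * int (card (range (gold_map i j :: 'a \<Rightarrow> 'a))) = 2 * 2 ^ (m - 1)" using m by (simp add: power_eq_if)
  moreover have "card (range (gold_map i j :: 'a \<Rightarrow> 'a)) = card D + 1" unfolding insert using zero_notin by simp
  ultimately show card_D: "int (card D) = 2 ^ (m - 1) - 1" by simp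
  have "walsh m i j a = 2 * (\<Sum>y\<in>insert 0 D. trace_char m (a * y))"
    unfolding walsh_def insert[symmetric] by (rule sum_two_to_one_range[OF two])
  also have "\<dots> = 2 * (1 + (\<Sum>y\<in>D. trace_char m (a * y)))"
    using zero_notin by (simp add: trace_char_0)
  also have "(\<Sum>y\<in>D. trace_char m (a * y)) = (\<Sum>y\<in>D. 1 - 2 * of_bool (abs_trace m (a * y) \<noteq> 0))"
    by (intro sum.cong) (auto simp: trace_char_def)
  also have "\<dots> = int (card D) - 2 * int (card {d \<in> D. abs_trace m (a * d) \<noteq> 0})"
    by (simp add: sum_subtractf sum_distrib_left[symmetric] Int_def)
  also have "{d \<in> D. abs_trace m (a * d) \<noteq> 0} = {d \<in> D. codeword m D a d \<noteq> 0}"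
    by (auto simp: codeword_def)
  finally show "4 * int (hweight D (codeword m D a)) = 2 ^ m - walsh m i j a"
    using card_D m by (simp add: hweight_def power_eq_if)
qed

text \<open>Summing over \<open>a\<close> first leaves only the two zeros of
  \<open>gold_map i j\<close>.\<close>

lemma sum_walsh: "(\<Sum>a\<in>(UNIV :: 'a set). walsh m i j a) = 2 * 2 ^ m"
proof -
  have "(\<Sum>a\<in>(UNIV :: 'a set). walsh m i j a) = (\<Sum>x\<in>(UNIV :: 'a set). \<Sum>a\<in>(UNIV :: 'a set). trace_char m (gold_map i j x * a))"
    unfolding walsh_def by (subst sum.swap) (simp add: mult.commute)
  also have "\<dots> = (\<Sum>x\<in>(UNIV :: 'a set). if gold_map i j x = 0 then 2 ^ m else 0)"
    by (simp add: sum_trace_char)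
  also have "\<dots> = (\<Sum>x\<in>{x :: 'a. gold_map i j x = 0}. 2 ^ m)"
    by (simp add: sum.If_cases)
  finally show ?thesis by (simp add: fibre_0)
qed

text \<open>Summing over \<open>a\<close> first counts the pairs with equal image, two for each
  \<open>x\<close>.\<close>

lemma sum_walsh_square: "(\<Sum>a\<in>(UNIV :: 'a set). walsh m i j a ^ 2) = 2 * (2 ^ m) ^ 2"
proof -
  have "(\<Sum>a\<in>(UNIV :: 'a set). walsh m i j a ^ 2) =
      (\<Sum>a\<in>(UNIV :: 'a set). \<Sum>x\<in>(UNIV :: 'a set). \<Sum>y\<in>(UNIV :: 'a set). trace_char m ((gold_map i j x + gold_map i j y) * a))"
    by (simp add: walsh_def power2_eq_square sum_product trace_char_add algebra_simps)
  also have "\<dots> = (\<Sum>x\<in>(UNIV :: 'a set). \<Sum>y\<in>(UNIV :: 'a set). \<Sum>a\<in>(UNIV :: 'a set). trace_char m ((gold_map i j x + gold_map i j y) * a))"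
    by (subst sum.swap, rule sum.cong[OF refl], rule sum.swap)
  also have "\<dots> = (\<Sum>x\<in>(UNIV :: 'a set). \<Sum>y\<in>(UNIV :: 'a set). if gold_map i j x = gold_map i j y then 2 ^ m else 0)"
    by (simp add: sum_trace_char add_eq_0_iff_eq)
  also have "\<dots> = (\<Sum>x\<in>(UNIV :: 'a set). 2 * 2 ^ m)"
    by (simp add: sum.If_cases card_fibre)
  finally show ?thesis by (simp add: card_UNIV_eq power2_eq_square)
qed

text \<open>By Frobenius invariance of the trace, raising the two terms to the powers
  \<open>2 ^ (m - i)\<close> and \<open>2 ^ (m - j)\<close> turns the argument into
  \<open>c * x\<close>.\<close>

lemma derivative_exponent_sum:
  fixes a h :: 'a
  shows
  "(\<Sum>x\<in>UNIV. trace_char m (a * (x ^ (2 ^ i) * h ^ (2 ^ j) + x ^ (2 ^ j) * h ^ (2 ^ i)))) =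
    (if a ^ (2 ^ (j - i)) * h ^ (2 ^ (j + (j - i))) = a * h ^ (2 ^ i) then 2 ^ m else 0)"
proof -
  have id: "x ^ (2 ^ (m + s)) = x ^ (2 ^ s)" for x :: 'a and s
    using power_frobenius_mod[of x "m + s"] power_frobenius_mod[of x s]
    by simp
  have pp: "(x ^ (2 ^ s)) ^ (2 ^ t) = x ^ (2 ^ (s + t))" for x :: 'a and s t
    by (simp add: power_add power_mult)
  define c where "c = a ^ (2 ^ (m - i)) * h ^ (2 ^ (j + (m - i))) +
    a ^ (2 ^ (m - j)) * h ^ (2 ^ (i + (m - j)))"
  have "trace_char m (a * (x ^ (2 ^ i) * h ^ (2 ^ j) + x ^ (2 ^ j) * h ^ (2 ^ i))) = trace_char m (c * x)" for x
  proof -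
    have 1: "trace_char m (a * x ^ (2 ^ i) * h ^ (2 ^ j)) = trace_char m (a ^ (2 ^ (m - i)) * h ^ (2 ^ (j + (m - i))) * x)"
    proof -
      have "(a * x ^ (2 ^ i) * h ^ (2 ^ j)) ^ (2 ^ (m - i)) = a ^ (2 ^ (m - i)) * h ^ (2 ^ (j + (m - i))) * x"
        using id[of x 0] ij jm by (simp add: power_mult_distrib pp)
      thus ?thesis using trace_char_frobenius[of "a * x ^ (2 ^ i) * h ^ (2 ^ j)" "m - i"] by simp
    qed
    have 2: "trace_char m (a * x ^ (2 ^ j) * h ^ (2 ^ i)) = trace_char m (a ^ (2 ^ (m - j)) * h ^ (2 ^ (i + (m - j))) * x)"
    proof -
      have "(a * x ^ (2 ^ j) * h ^ (2 ^ i)) ^ (2 ^ (m - j)) = a ^ (2 ^ (m - j)) * h ^ (2 ^ (i + (m - j))) * x"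
        using id[of x 0] ij jm by (simp add: power_mult_distrib pp)
      thus ?thesis using trace_char_frobenius[of "a * x ^ (2 ^ j) * h ^ (2 ^ i)" "m - j"] by simp
    qed
    show ?thesis
      unfolding c_def distrib_left distrib_right trace_char_add using 1 2 by (simp add: mult.assoc)
  qed
  hence "(\<Sum>x\<in>UNIV. trace_char m (a * (x ^ (2 ^ i) * h ^ (2 ^ j) + x ^ (2 ^ j) * h ^ (2 ^ i)))) =
      (if c = 0 then 2 ^ m else 0)"
    by (simp add: sum_trace_char)
  moreover have "c = 0 \<longleftrightarrow> a ^ (2 ^ (j - i)) * h ^ (2 ^ (j + (j - i))) = a * h ^ (2 ^ i)"
  proof -
    \<comment> \<open>Raising to \<open>2 ^ j\<close> lifts each exponent above \<open>m\<close>,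
      where it can be reduced by \<open>m\<close>.\<close>
    have "c = 0 \<longleftrightarrow> c ^ (2 ^ j) = 0" by simp
    also have "c ^ (2 ^ j) = a ^ (2 ^ (m - i + j)) * h ^ (2 ^ (j + (m - i) + j)) +
        a ^ (2 ^ (m - j + j)) * h ^ (2 ^ (i + (m - j) + j))"
      unfolding c_def frobenius_add by (simp only: power_mult_distrib pp)
    also have "\<dots> = a ^ (2 ^ (j - i)) * h ^ (2 ^ (j + (j - i))) + a ^ (2 ^ 0) * h ^ (2 ^ i)"
    proof -
      have "m - i + j = m + (j - i)" "j + (m - i) + j = m + (j + (j - i))"
        "m - j + j = m + 0" "i + (m - j) + j = m + i"
        using ij jm by simp_all
      thus ?thesis by (simp only: id)
    qed
    finally show ?thesis by (simp add: add_eq_0_iff_eq)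
  qed
  ultimately show ?thesis by simp
qed

text \<open>Multiplied by \<open>h ^ (2 ^ j)\<close>, the equation says that \<open>z\<close> is
  fixed by a Frobenius power whose exponent is coprime to \<open>m\<close>.\<close>

lemma radical_iff:
  fixes a h :: 'a
  assumes "coprime (j - i) m" "a \<noteq> 0" "h \<noteq> 0"
  shows "a ^ (2 ^ (j - i)) * h ^ (2 ^ (j + (j - i))) = a * h ^ (2 ^ i) \<longleftrightarrow> h ^ (2 ^ i + 2 ^ j) = inverse a"
proof -
  define z where "z = a * h ^ (2 ^ i + 2 ^ j)"
  have z: "z \<noteq> 0" using assms by (simp add: z_def)
  have "2 ^ i * 2 ^ (j - i) = (2 :: nat) ^ j" using ij by (simp flip: power_add)
  hence "z ^ (2 ^ (j - i)) = a ^ (2 ^ (j - i)) * h ^ (2 ^ (j + (j - i))) * h ^ (2 ^ j)"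
    by (simp add: z_def power_mult_distrib power_add distrib_right flip: power_mult)
  moreover have "z = a * h ^ (2 ^ i) * h ^ (2 ^ j)" by (simp add: z_def power_add)
  ultimately have "a ^ (2 ^ (j - i)) * h ^ (2 ^ (j + (j - i))) = a * h ^ (2 ^ i) \<longleftrightarrow> z ^ (2 ^ (j - i)) = z"
    using assms by simp
  also have "\<dots> \<longleftrightarrow> z = 1" using frobenius_fixed_imp_1[OF assms(1) _ z] by auto
  also have "\<dots> \<longleftrightarrow> h ^ (2 ^ i + 2 ^ j) = inverse a"
    using assms by (auto simp: z_def field_simps)
  finally show ?thesis .
qed

lemma walsh_square:
  fixes a :: 'a
  assumes "coprime (j - i) m" "coprime (2 ^ i + 2 ^ j) (2 ^ m - 1 :: nat)" "a \<noteq> 0"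
  shows "walsh m i j a ^ 2 = 0 \<or> walsh m i j a ^ 2 = 2 * 2 ^ m"
proof -
  have "inverse a \<noteq> 0" using assms(3) by simp
  from unique_root_if_coprime[OF assms(2) this] obtain h0 where
    h0: "h0 \<noteq> 0" "\<forall>h. h ^ (2 ^ i + 2 ^ j) = inverse a \<and> h \<noteq> 0 \<longleftrightarrow> h = h0"
    by (elim exE conjE)
  define rad where "rad h \<longleftrightarrow> a ^ (2 ^ (j - i)) * h ^ (2 ^ (j + (j - i))) = a * h ^ (2 ^ i)" for h
  have rad: "{h. rad h} = {0, h0}"
  proof (rule Set.set_eqI)
    fix h
    show "h \<in> {h. rad h} \<longleftrightarrow> h \<in> {0, h0}"
    proof (cases "h = 0")
      case False
      thus ?thesis using radical_iff[OF assms(1,3) False] spec[OF h0(2), of h] by (simp add: rad_def)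
    qed (simp add: rad_def power_0_left)
  qed
  have "walsh m i j a ^ 2 = (\<Sum>x\<in>UNIV. \<Sum>y\<in>UNIV. trace_char m (a * (gold_map i j x + gold_map i j y)))"
    by (simp add: walsh_def power2_eq_square sum_product distrib_left trace_char_add)
  also have "\<dots> = (\<Sum>x\<in>UNIV. \<Sum>h\<in>UNIV. trace_char m (a * (gold_map i j x + gold_map i j (x + h))))"
  proof (rule sum.cong[OF refl])
    fix x
    show "(\<Sum>y\<in>UNIV. trace_char m (a * (gold_map i j x + gold_map i j y))) = (\<Sum>h\<in>UNIV. trace_char m (a * (gold_map i j x + gold_map i j (x + h))))"
      by (rule sum.reindex_bij_witness[of _ "\<lambda>h. x + h" "\<lambda>y. y - x"]) auto
  qed
  also have "\<dots> = (\<Sum>x\<in>UNIV. \<Sum>h\<in>UNIV. trace_char m (a * gold_map i j h) *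
      trace_char m (a * (x ^ (2 ^ i) * h ^ (2 ^ j) + x ^ (2 ^ j) * h ^ (2 ^ i))))"
  proof (intro sum.cong refl)
    fix x h :: 'a
    have two_eq_0: "(2 :: 'a) = 0" using add_self[of 1] by simp
    have "gold_map i j x + gold_map i j (x + h) = gold_map i j h + (x ^ (2 ^ i) * h ^ (2 ^ j) + x ^ (2 ^ j) * h ^ (2 ^ i))"
      by (simp add: gold_map_def power_add frobenius_add algebra_simps two_eq_0)
    thus "trace_char m (a * (gold_map i j x + gold_map i j (x + h))) = trace_char m (a * gold_map i j h) *
        trace_char m (a * (x ^ (2 ^ i) * h ^ (2 ^ j) + x ^ (2 ^ j) * h ^ (2 ^ i)))"
      by (simp only: distrib_left[of a "gold_map i j h"] trace_char_add)
  qed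
  also have "\<dots> = (\<Sum>h\<in>UNIV. trace_char m (a * gold_map i j h) * (if rad h then 2 ^ m else 0))"
    by (subst sum.swap) (simp only: sum_distrib_left[symmetric] derivative_exponent_sum rad_def)
  also have "\<dots> = (\<Sum>h\<in>{h. rad h}. trace_char m (a * gold_map i j h) * 2 ^ m)"
    by (simp add: if_distrib[of "\<lambda>t. _ * t"] sum.If_cases cong: if_cong)
  also have "\<dots> = 2 ^ m * (1 + trace_char m (a * gold_map i j h0))"
    using h0(1) by (simp add: rad gold_map_def trace_char_0 algebra_simps power_0_left)
  finally show ?thesis by (simp add: trace_char_def)
qed

end

end

section \<open>The weight distribution\<close>

theorem mainTheorem4:
  fixes m i j :: nat
  assumes card: "card (UNIV :: 'a::{field,finite} set) = 2 ^ m"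
    and m3: "m \<ge> 3" and modd: "odd m"
    and ij: "i < j" and jm: "j < m"
    and two_to_one: "\<forall>y::'a. card {x::'a. x ^ (2^i + 2^j) + x = y} \<in> {0, 2}"
    and gcd1: "gcd (2 ^ (j - i) + 1) (2 ^ m - 1 :: nat) = 1"
  defines "D \<equiv> (\<lambda>x::'a. x ^ (2^i + 2^j) + x) ` UNIV - {0}"
  shows "card D = 2 ^ (m - 1) - 1
    \<and> card (code_D m D) = 2 ^ m
    \<and> min_distance m D = 2 ^ (m - 2) - 2 ^ ((m - 3) div 2)
    \<and> (\<forall>c \<in> code_D m D. c \<noteq> (\<lambda>_. 0) \<longrightarrow>
         hweight D c \<in> {2 ^ (m - 2) - 2 ^ ((m - 3) div 2), 2 ^ (m - 2), 2 ^ (m - 2) + 2 ^ ((m - 3) div 2)})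
    \<and> weight_mult m D (2 ^ (m - 2) - 2 ^ ((m - 3) div 2)) = 2 ^ (m - 2) + 2 ^ ((m - 3) div 2)
    \<and> weight_mult m D (2 ^ (m - 2)) = 2 ^ (m - 1) - 1
    \<and> weight_mult m D (2 ^ (m - 2) + 2 ^ ((m - 3) div 2)) = 2 ^ (m - 2) - 2 ^ ((m - 3) div 2)"
proof -
  define W where "W a = walsh m i j a" for a :: 'a
  have two: "\<forall>y::'a. card {x. gold_map i j x = y} \<in> {0, 2}"
    unfolding gold_map_def by (rule two_to_one)
  have D_eq: "D = range (gold_map i j) - {0}" by (simp add: D_def gold_map_def)
  define wt where "wt a = hweight D (codeword m D a)" for a
  define k where "k = (m - 3) div 2"
  \<comment> \<open>With \<open>u = 2 ^ k\<close>, all quantities become polynomials in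
    \<open>u\<close>, and the nonzero \<open>W a\<close> are \<open>4 * u\<close> up to
    sign.\<close>
  have mk: "m = 2 * k + 3" using m3 modd by (auto simp: k_def elim!: oddE)
  define u :: nat where "u = 2 ^ k"
  have u: "u > 0" by (simp add: u_def)
  have pm: "2 ^ m = 8 * u ^ 2" "2 ^ (m - 1) = 4 * u ^ 2" "2 ^ (m - 2) = 2 * u ^ 2"
    by (simp_all add: mk u_def power_add power_mult power2_eq_square flip: power_mult_distrib)
  have pmi: "(2 :: int) ^ m = 8 * int u ^ 2" "(2 :: int) ^ (m - 1) = 4 * int u ^ 2"
    using arg_cong[OF pm(1), of int] arg_cong[OF pm(2), of int] by simp_all
  have uu: "u \<le> u ^ 2" using u by (simp add: power2_eq_square)
  have cop: "coprime (j - i) m" by (rule coprime_diff_exponents[OF card ij jm two modd])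
  have cop2: "coprime (2 ^ i + 2 ^ j) (2 ^ m - 1 :: nat)"
  proof -
    have "2 ^ i + 2 ^ j = 2 ^ i * (2 ^ (j - i) + 1 :: nat)"
      using ij by (simp add: distrib_left flip: power_add)
    moreover have "coprime (2 ^ i) (2 ^ m - 1 :: nat)" using m3 by (simp add: coprime_left_2_iff_odd)
    moreover have "coprime (2 ^ (j - i) + 1) (2 ^ m - 1 :: nat)"
      using gcd1 by (simp only: coprime_iff_gcd_eq_1)
    ultimately show ?thesis by (simp only: coprime_mult_left_iff)
  qed
  have card_D: "int (card D) = 4 * int u ^ 2 - 1"
    unfolding D_eq pmi(2)[symmetric] by (rule walsh_weight(1)[OF card ij jm two])
  have wt: "4 * int (wt a) = 8 * int u ^ 2 - W a" for a
    using walsh_weight(2)[OF card ij jm two] by (simp add: D_eq wt_def W_def pmi)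
  have W_cases: "W a = 0 \<or> W a = 4 * int u \<or> W a = - (4 * int u)" if "a \<noteq> 0" for a
  proof -
    have "W a ^ 2 = 0 \<or> W a ^ 2 = 2 * 2 ^ m"
      using walsh_square[OF card ij jm two cop cop2 that] by (simp add: W_def)
    hence "W a ^ 2 = 0 \<or> W a ^ 2 = (4 * int u) ^ 2" by (simp add: pmi power_mult_distrib)
    thus ?thesis unfolding power2_eq_iff by auto
  qed
  have W0: "W 0 = 8 * int u ^ 2"
    using card by (simp add: W_def walsh_def trace_char_0[OF card] pm)
  have sumW: "(\<Sum>a\<in>UNIV. W a) = 16 * int u ^ 2"
    using sum_walsh[OF card ij jm two] by (simp add: W_def pmi)
  have sumW2: "(\<Sum>a\<in>UNIV. W a ^ 2) = 2 * (8 * int u ^ 2) ^ 2"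
    using sum_walsh_square[OF card ij jm two] by (simp add: W_def pmi)
  define N where "N s = {a :: 'a. a \<noteq> 0 \<and> W a = s}" for s
  define n0 where "n0 = int (card (N 0))"
  define n1 where "n1 = int (card (N (4 * int u)))"
  define n2 where "n2 = int (card (N (- (4 * int u))))"
  have split: "(\<Sum>a\<in>UNIV. f (W a)) = f (W 0) + f 0 * n0 + f (4 * int u) * n1 + f (- (4 * int u)) * n2"
    for f :: "int \<Rightarrow> int"
  proof -
    have const: "(\<Sum>a\<in>N s. f (W a)) = f s * int (card (N s))" for s by (simp add: N_def)
    have "UNIV = insert 0 (N 0 \<union> N (4 * int u) \<union> N (- (4 * int u)))"
      using W_cases by (auto simp: N_def)
    hence "(\<Sum>a\<in>UNIV. f (W a)) = (\<Sum>a\<in>insert 0 (N 0 \<union> N (4 * int u) \<union> N (- (4 * int u))). f (W a))"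
      by simp
    also have "\<dots> = f (W 0) + (\<Sum>a\<in>N 0 \<union> N (4 * int u) \<union> N (- (4 * int u)). f (W a))"
      by (rule sum.insert) (auto simp: N_def)
    also have "(\<Sum>a\<in>N 0 \<union> N (4 * int u) \<union> N (- (4 * int u)). f (W a)) =
        (\<Sum>a\<in>N 0. f (W a)) + (\<Sum>a\<in>N (4 * int u). f (W a)) + (\<Sum>a\<in>N (- (4 * int u)). f (W a))"
      using u by (subst sum.union_disjoint; (subst sum.union_disjoint)?) (auto simp: N_def)
    finally show ?thesis by (simp add: const n0_def n1_def n2_def)
  qed
  \<comment> \<open>The moments of order 0, 1 and 2, with the term at \<open>a = 0\<close> split
    off, form a linear system for the three multiplicities.\<close>
  have "8 * int u ^ 2 = 1 + n0 + n1 + n2"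
    using split[of "\<lambda>_. 1"] card pmi by (simp add: W0)
  moreover have "int u * (n1 - n2) = int u * (2 * int u)"
    using split[of "\<lambda>s. s"] sumW by (simp add: W0 algebra_simps power2_eq_square)
  hence "n1 - n2 = 2 * int u" using u by simp
  moreover have "int u ^ 2 * (n1 + n2) = int u ^ 2 * (4 * int u ^ 2)"
    using split[of "\<lambda>s. s ^ 2"] sumW2 by (simp add: W0 algebra_simps power2_eq_square)
  hence "n1 + n2 = 4 * int u ^ 2" using u by simp
  ultimately have n: "n0 = 4 * int u ^ 2 - 1" "n1 = 2 * int u ^ 2 + int u" "n2 = 2 * int u ^ 2 - int u"
    by linarith+
  have uui: "int u \<le> int u ^ 2" using uu by (metis of_nat_le_iff of_nat_power)
  \<comment> \<open>The smallest possible weight is \<open>2 * u ^ 2 - u\<close>; its positivity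
    yields injectivity of the encoding, hence dimension \<open>m\<close>.\<close>
  have wt_pos: "wt a > 0" if "a \<noteq> 0" for a
    using W_cases[OF that] wt[of a] uui u by (elim disjE) linarith+
  have codeword_0: "codeword m D 0 = (\<lambda>_. 0)"
    by (intro ext) (simp add: codeword_def abs_trace_0[OF card])
  have codeword_eq_0: "codeword m D a = (\<lambda>_. 0) \<longleftrightarrow> a = 0" for a
  proof
    assume "codeword m D a = (\<lambda>_. 0)"
    hence "wt a = 0" by (simp add: wt_def hweight_def)
    thus "a = 0" using wt_pos[of a] by (metis less_irrefl)
  qed (use codeword_0 in simp)
  have inj: "inj (codeword m D)"
  proof (rule injI)
    fix a b assume eq: "codeword m D a = codeword m D b"
    have "codeword m D (a + b) = (\<lambda>d. codeword m D a d + codeword m D b d)"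
      by (auto simp: codeword_def distrib_right abs_trace_add[OF card])
    also have "\<dots> = (\<lambda>_. 0)" by (simp add: eq add_self[OF card])
    finally show "a = b" by (simp add: codeword_eq_0 add_eq_0_iff_eq[OF card])
  qed
  have mult: "weight_mult m D w = card {a. a \<noteq> 0 \<and> wt a = w}" for w
  proof -
    have "{c \<in> code_D m D. c \<noteq> (\<lambda>_. 0) \<and> hweight D c = w} = codeword m D ` {a. a \<noteq> 0 \<and> wt a = w}"
      by (auto simp: code_D_def wt_def codeword_eq_0)
    thus ?thesis unfolding weight_mult_def using inj by (simp add: card_image inj_on_def)
  qed
  \<comment> \<open>The correspondence reverses order: the largest \<open>W a\<close> gives the
    smallest weight.\<close>
  have wt_sets: "{a. a \<noteq> 0 \<and> wt a = 2 * u ^ 2 - u} = N (4 * int u)"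
      "{a. a \<noteq> 0 \<and> wt a = 2 * u ^ 2} = N 0"
      "{a. a \<noteq> 0 \<and> wt a = 2 * u ^ 2 + u} = N (- (4 * int u))"
  proof -
    have i2: "int (2 * u ^ 2) = 2 * int u ^ 2" by simp
    have i: "int (2 * u ^ 2 - u) = 2 * int u ^ 2 - int u" using uu by (simp add: of_nat_diff)
    have "wt a = 2 * u ^ 2 - u \<longleftrightarrow> W a = 4 * int u" for a
      using wt[of a] i by linarith
    moreover have "wt a = 2 * u ^ 2 \<longleftrightarrow> W a = 0" for a
      using wt[of a] i2 by linarith
    moreover have "wt a = 2 * u ^ 2 + u \<longleftrightarrow> W a = - (4 * int u)" for a
      using wt[of a] i2 by linarith
    ultimately show "{a. a \<noteq> 0 \<and> wt a = 2 * u ^ 2 - u} = N (4 * int u)"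
      "{a. a \<noteq> 0 \<and> wt a = 2 * u ^ 2} = N 0"
      "{a. a \<noteq> 0 \<and> wt a = 2 * u ^ 2 + u} = N (- (4 * int u))" by (simp_all add: N_def)
  qed
  have weights: "wt a \<in> {2 * u ^ 2 - u, 2 * u ^ 2, 2 * u ^ 2 + u}" if "a \<noteq> 0" for a
    using W_cases[OF that] that wt_sets by (auto simp: N_def)
  have u2: "int (u ^ 2) = int u ^ 2" by simp
  have "card D = 4 * u ^ 2 - 1" using card_D u2 by linarith
  moreover have "card (code_D m D) = 8 * u ^ 2"
    using inj card by (simp add: code_D_def card_image pm)
  moreover have "\<forall>c \<in> code_D m D. c \<noteq> (\<lambda>_. 0) \<longrightarrow>
      hweight D c \<in> {2 * u ^ 2 - u, 2 * u ^ 2, 2 * u ^ 2 + u}"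
    using weights by (auto simp: code_D_def wt_def codeword_eq_0)
  moreover have m1: "weight_mult m D (2 * u ^ 2 - u) = 2 * u ^ 2 + u"
    unfolding mult wt_sets using n(2) u2 unfolding n1_def by linarith
  moreover have "weight_mult m D (2 * u ^ 2) = 4 * u ^ 2 - 1"
    unfolding mult wt_sets using n(1) u2 unfolding n0_def by linarith
  moreover have "weight_mult m D (2 * u ^ 2 + u) = 2 * u ^ 2 - u"
    unfolding mult wt_sets using n(3) u2 uu unfolding n2_def by linarith
  moreover have "min_distance m D = 2 * u ^ 2 - u"
  proof -
    have "hweight D ` (code_D m D - {\<lambda>_. 0}) = wt ` (UNIV - {0})"
      by (auto simp: code_D_def wt_def codeword_eq_0 image_iff)
    moreover have "Min (wt ` (UNIV - {0})) = 2 * u ^ 2 - u"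
    proof (rule Min_eqI)
      show "finite (wt ` (UNIV - {0}))" by simp
      show "2 * u ^ 2 - u \<le> w" if "w \<in> wt ` (UNIV - {0})" for w
        using that weights by fastforce
      \<comment> \<open>The lower bound is attained because its multiplicity is positive.\<close>
      have "card {a. a \<noteq> 0 \<and> wt a = 2 * u ^ 2 - u} \<noteq> 0" using m1 u by (simp add: mult)
      then obtain a where "a \<noteq> 0" "wt a = 2 * u ^ 2 - u" by (auto simp: card_eq_0_iff)
      thus "2 * u ^ 2 - u \<in> wt ` (UNIV - {0})" by (metis DiffI UNIV_I imageI singletonD)
    qed
    ultimately show ?thesis by (simp add: min_distance_def)
  qed
  ultimately show ?thesis
    unfolding pm k_def[symmetric] u_def[symmetric] by blast
qed

end
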